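(* Let $X$ be a symmetrically regular complex Banach space, and let $\eta:[0,\infty[\to]0,\infty[$ be a decreasing continuous function with $\lim_{t\to\infty}t^k\eta(t)=0$ for every $k\in\mathbb N$, for which there is $C>0$ such that $\eta(s)\eta(t)\le C\,\eta(s+t)$ for all $s,t\ge0$. Let $V=\{v_n\}_{n\ge1}$ be defined by $v_n(x)=\eta(\|x\|)^{1/n}$, $x\in X$. Then, for every $f\in HV(X)$, the associated function $f'':\mathfrak MV(X)\to\mathbb C$ given by $f''(\phi)=\phi(f)$ is holomorphic.
   Context: $X$ is symmetrically regular if every continuous linear $T:X\to X^*$ that is symmetric ($Tx_1(x_2)=Tx_2(x_1)$ for all $x_1,x_2\in X$) is weakly compact. $HV(X)$ is the space of holomorphic $f:X\to\mathbb C$ with $\|f\|_{v_n}:=\sup_{x}v_n(x)|f(x)|<\infty$ for all $n$, with the Fréchet topology given by these seminorms; under the hypotheses it is a locally convex algebra under pointwise multiplication and contains all continuous polynomials. Its spectrum $\mathfrak MV(X)$ is the set of non-zero continuous multiplicative linear functionals on $HV(X)$. For $f\in HV(X)$, $\bar f:X^{**}\to\mathbb C$ denotes its Aron–Berner extension: if $f=\sum_nP_n$ is the Taylor series at $0$ and $A_n$ is the symmetric $n$-linear form of $P_n$, then $\bar f(z)=\sum_n\bar A_n(z,\dots,z)$, where $\bar A_n(z_1,\dots,z_n)=\lim_{\alpha_1}\cdots\lim_{\alpha_n}A_n(x_{\alpha_1},\dots,x_{\alpha_n})$ for nets in $X$ with $x_{\alpha_i}\to z_i$ weak-star. $J_X:X\to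 X^{**}$ is the canonical embedding. For $z\in X^{**}$, $\tau_z:HV(X)\to HV(X)$ is the (well defined, continuous) homomorphism $(\tau_zf)(x)=\bar f(J_Xx+z)$, so $\phi\circ\tau_z\in\mathfrak MV(X)$ for every $\phi\in\mathfrak MV(X)$. Analytic structure: let $\pi:\mathfrak MV(X)\to X^{**}$, $\pi(\phi)=\phi|_{X^*}$; then $\pi(\phi\circ\tau_z)=\pi(\phi)+z$. For $\phi\in\mathfrak MV(X)$ and $\varepsilon>0$ put $V_{\phi,\varepsilon}=\{\phi\circ\tau_z: z\in X^{**},\ \|z\|<\varepsilon\}$ and $V_{\phi,\infty}=\bigcup_{\varepsilon>0}V_{\phi,\varepsilon}$. The sets $\{V_{\phi,\varepsilon}\}_{\varepsilon>0}$ are a neighbourhood basis at $\phi$ for a Hausdorff topology on $\mathfrak MV(X)$, making $(\mathfrak MV(X),\pi)$ a Riemann domain over $X^{**}$, where $\pi|_{V_{\phi,\infty}}:V_{\phi,\infty}\to X^{**}$ is a bijection. A function $g:\mathfrak MV(X)\to\mathbb C$ is holomorphic if $g\circ(\pi|_{V_{\phi,\infty}})^{-1}$ is holomorphic on $X^{**}$ for every $\phi\in\mathfrak MV(X)$. *)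

theory Defs
  imports "HOL-Analysis.Analysis" "HOL-Library.Multiset"
begin

section \<open>Complex Banach spaces\<close>

class complex_normed_vector = real_normed_vector +
  fixes scaleC :: "complex \<Rightarrow> 'a \<Rightarrow> 'a"  (infixr \<open>*\<^sub>C\<close> 75)
  assumes scaleC_of_real: "complex_of_real r *\<^sub>C x = r *\<^sub>R x"
    and scaleC_add_right: "c *\<^sub>C (x + y) = c *\<^sub>C x + c *\<^sub>C y"
    and scaleC_add_left: "(c + d) *\<^sub>C x = c *\<^sub>C x + d *\<^sub>C x"
    and scaleC_scaleC: "c *\<^sub>C d *\<^sub>C x = (c * d) *\<^sub>C x"
    and norm_scaleC: "norm (c *\<^sub>C x) = cmod c * norm x"

class complex_banach = complex_normed_vector + banach

instantiation complex :: complex_banach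
begin

definition scaleC_complex :: "complex \<Rightarrow> complex \<Rightarrow> complex"
  where "scaleC_complex c x = c * x"

instance
  by standard
    (simp_all add: scaleC_complex_def scaleR_conv_of_real algebra_simps norm_mult)

end

definition clinear :: "('a::complex_normed_vector \<Rightarrow> 'b::complex_normed_vector) \<Rightarrow> bool"
  where "clinear f \<longleftrightarrow> (\<forall>x y. f (x + y) = f x + f y) \<and> (\<forall>c x. f (c *\<^sub>C x) = c *\<^sub>C f x)"


section \<open>The dual space\<close>

text \<open>The norm is the operator norm, inherited from the space of bounded real-linear maps
  into the complex numbers.\<close>

typedef (overloaded) 'a cdual =
  "{f :: 'a::complex_normed_vector \<Rightarrow>\<^sub>L complex. clinear (blinfun_apply f)}"
  morphisms blinfun_of_cdual Abs_cdual
  by (rule exI[of _ 0]) (simp add: clinear_def scaleC_complex_def)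

definition cdual_apply :: "'a::complex_normed_vector cdual \<Rightarrow> 'a \<Rightarrow> complex"
  where "cdual_apply \<gamma> = blinfun_apply (blinfun_of_cdual \<gamma>)"

setup_lifting type_definition_cdual

instantiation cdual :: (complex_normed_vector) complex_normed_vector
begin

lift_definition zero_cdual :: "'a cdual" is 0
  by (simp add: clinear_def scaleC_complex_def)

lift_definition plus_cdual :: "'a cdual \<Rightarrow> 'a cdual \<Rightarrow> 'a cdual" is "(+)"
  by (simp add: clinear_def scaleC_complex_def plus_blinfun.rep_eq algebra_simps)

lift_definition minus_cdual :: "'a cdual \<Rightarrow> 'a cdual \<Rightarrow> 'a cdual" is "(-)"
  by (simp add: clinear_def scaleC_complex_def minus_blinfun.rep_eq algebra_simps)

lift_definition uminus_cdual :: "'a cdual \<Rightarrow> 'a cdual" is uminus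
  by (simp add: clinear_def scaleC_complex_def uminus_blinfun.rep_eq)

lift_definition scaleR_cdual :: "real \<Rightarrow> 'a cdual \<Rightarrow> 'a cdual" is "(*\<^sub>R)"
  by (simp add: clinear_def scaleC_complex_def scaleR_blinfun.rep_eq scaleR_conv_of_real
      algebra_simps)

lift_definition scaleC_cdual :: "complex \<Rightarrow> 'a cdual \<Rightarrow> 'a cdual"
  is "\<lambda>c f. blinfun_compose (blinfun_mult_right c) f"
  by (simp add: clinear_def scaleC_complex_def algebra_simps)

lift_definition norm_cdual :: "'a cdual \<Rightarrow> real" is norm .

definition dist_cdual :: "'a cdual \<Rightarrow> 'a cdual \<Rightarrow> real"
  where "dist_cdual a b = norm (a - b)"

definition uniformity_cdual :: "('a cdual \<times> 'a cdual) filter"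
  where "uniformity_cdual = (INF e\<in>{0 <..}. principal {(x, y). dist x y < e})"

definition open_cdual :: "'a cdual set \<Rightarrow> bool"
  where
    "open_cdual S = (\<forall>x\<in>S. \<forall>\<^sub>F (x', y) in uniformity. x' = x \<longrightarrow> y \<in> S)"

definition sgn_cdual :: "'a cdual \<Rightarrow> 'a cdual"
  where "sgn_cdual x = inverse (norm x) *\<^sub>R x"

instance
proof
  fix a b c :: "'a cdual" and r s :: real and u w :: complex
  note rep = blinfun_of_cdual_inject[symmetric] zero_cdual.rep_eq plus_cdual.rep_eq
    minus_cdual.rep_eq uminus_cdual.rep_eq scaleR_cdual.rep_eq scaleC_cdual.rep_eq
    norm_cdual.rep_eq
  show "a + b + c = a + (b + c)" "a + b = b + a" "0 + a = a" "- a + a = 0" "a - b = a + - b"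
    by (simp_all add: rep)
  show "r *\<^sub>R (a + b) = r *\<^sub>R a + r *\<^sub>R b" "(r + s) *\<^sub>R a = r *\<^sub>R a + s *\<^sub>R a"
    "r *\<^sub>R s *\<^sub>R a = (r * s) *\<^sub>R a" "1 *\<^sub>R a = a"
    by (simp_all add: rep scaleR_add_right scaleR_add_left)
  show "norm a = 0 \<longleftrightarrow> a = 0" "norm (a + b) \<le> norm a + norm b"
    "norm (r *\<^sub>R a) = \<bar>r\<bar> * norm a"
    by (simp_all add: rep norm_triangle_ineq)
  show "complex_of_real r *\<^sub>C a = r *\<^sub>R a"
    "u *\<^sub>C (a + b) = u *\<^sub>C a + u *\<^sub>C b" "(u + w) *\<^sub>C a = u *\<^sub>C a + w *\<^sub>C a"
    "u *\<^sub>C w *\<^sub>C a = (u * w) *\<^sub>C a"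
    by (auto simp: rep plus_blinfun.rep_eq scaleR_blinfun.rep_eq scaleR_conv_of_real
        distrib_left distrib_right mult.assoc intro!: blinfun_eqI)
  show "norm (u *\<^sub>C a) = cmod u * norm a"
  proof -
    let ?f = "blinfun_of_cdual a" and ?g = "blinfun_of_cdual (u *\<^sub>C a)"
    have eq: "?g x = u * ?f x" for x
      by (simp add: scaleC_cdual.rep_eq)
    have "norm ?g \<le> cmod u * norm ?f"
      by (rule norm_blinfun_bound)
        (auto simp: eq norm_mult mult.assoc intro!: mult_left_mono norm_blinfun)
    moreover have "cmod u * norm ?f \<le> norm ?g"
    proof (cases "u = 0")
      case False
      have "norm ?f \<le> norm ?g / cmod u"
      proof (rule norm_blinfun_bound)
        show "cmod (?f x) \<le> norm ?g / cmod u * norm x" for x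
          using norm_blinfun[of ?g x] False by (simp add: eq norm_mult field_simps)
      qed simp
      then show ?thesis
        using False by (simp add: field_simps)
    qed simp
    ultimately show ?thesis
      by (simp add: norm_cdual.rep_eq)
  qed
qed (rule dist_cdual_def uniformity_cdual_def open_cdual_def sgn_cdual_def)+

end

instance cdual :: (complex_normed_vector) complex_banach
proof
  fix X :: "nat \<Rightarrow> 'a cdual"
  assume "Cauchy X"
  have d: "dist (blinfun_of_cdual a) (blinfun_of_cdual b) = dist a b" for a b :: "'a cdual"
    by (simp add: dist_norm norm_cdual.rep_eq minus_cdual.rep_eq)
  from \<open>Cauchy X\<close> have "Cauchy (\<lambda>n. blinfun_of_cdual (X n))"
    by (simp add: Cauchy_def d)
  then obtain L where L: "(\<lambda>n. blinfun_of_cdual (X n)) \<longlonglongrightarrow> L"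
    by (meson Cauchy_convergent convergent_def)
  have lim: "(\<lambda>n. blinfun_of_cdual (X n) x) \<longlonglongrightarrow> L x" for x
    using L by (intro blinfun.tendsto tendsto_const)
  have cl: "clinear (blinfun_of_cdual (X n))" for n
    using blinfun_of_cdual[of "X n"] by simp
  have "L (c *\<^sub>C x) = c *\<^sub>C L x" for c x
  proof (rule LIMSEQ_unique[OF lim])
    show "(\<lambda>n. blinfun_of_cdual (X n) (c *\<^sub>C x)) \<longlonglongrightarrow> c *\<^sub>C L x"
      using tendsto_mult[OF tendsto_const[of c] lim[of x]] cl
      by (simp add: clinear_def scaleC_complex_def)
  qed
  then have "L \<in> {f. clinear (blinfun_apply f)}"
    by (simp add: clinear_def blinfun.add_right)
  then have "blinfun_of_cdual (Abs_cdual L) = L"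
    by (rule Abs_cdual_inverse)
  then have "dist (X n) (Abs_cdual L) = dist (blinfun_of_cdual (X n)) L" for n
    using d[of "X n" "Abs_cdual L"] by simp
  with L have "X \<longlonglongrightarrow> Abs_cdual L"
    by (simp add: tendsto_iff)
  then show "convergent X"
    by (auto simp: convergent_def)
qed

definition canonical_embedding :: "'a::complex_normed_vector \<Rightarrow> 'a cdual cdual"
  where "canonical_embedding x = (THE z. \<forall>\<gamma>. cdual_apply z \<gamma> = cdual_apply \<gamma> x)"


section \<open>Symmetric regularity\<close>

definition weak_topology :: "'a::complex_normed_vector topology"
  where "weak_topology =
    topology_generated_by {cdual_apply \<gamma> -` U |\<gamma> U. open U}"

definition weakly_compact_operator ::
    "('a::complex_normed_vector \<Rightarrow> 'b::complex_normed_vector) \<Rightarrow> bool"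
  where "weakly_compact_operator T \<longleftrightarrow>
    compactin weak_topology (weak_topology closure_of (T ` cball 0 1))"

definition symmetrically_regular :: "'a::complex_banach itself \<Rightarrow> bool"
  where "symmetrically_regular _ \<longleftrightarrow>
    (\<forall>T :: 'a \<Rightarrow> 'a cdual.
      clinear T \<and> continuous_on UNIV T \<and>
      (\<forall>x y. cdual_apply (T x) y = cdual_apply (T y) x) \<longrightarrow>
      weakly_compact_operator T)"


section \<open>Holomorphic functions and their Taylor series at the origin\<close>

definition entire :: "('a::complex_normed_vector \<Rightarrow> complex) \<Rightarrow> bool"
  where "entire f \<longleftrightarrow> (\<forall>x. \<exists>D. (f has_derivative D) (at x) \<and> clinear D)"

text \<open>An \<open>n\<close>-linear form is a function on lists of length \<open>n\<close>, extended by \<open>0\<close> to all other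
  lists so that it is determined by its values on the former. The norm bound is continuity.\<close>

definition symmetric_form :: "nat \<Rightarrow> ('a::complex_normed_vector list \<Rightarrow> complex) \<Rightarrow> bool"
  where "symmetric_form n A \<longleftrightarrow>
    (\<forall>xs. length xs \<noteq> n \<longrightarrow> A xs = 0) \<and>
    (\<forall>xs i. length xs = n \<and> i < n \<longrightarrow> clinear (\<lambda>x. A (xs[i := x]))) \<and>
    (\<forall>xs ys. mset xs = mset ys \<longrightarrow> A xs = A ys) \<and>
    (\<exists>K. \<forall>xs. length xs = n \<longrightarrow> cmod (A xs) \<le> K * prod_list (map norm xs))"

definition homogeneous_polynomial :: "nat \<Rightarrow> ('a::complex_normed_vector \<Rightarrow> complex) \<Rightarrow> bool"
  where "homogeneous_polynomial n P \<longleftrightarrow>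
    (\<exists>A. symmetric_form n A \<and> (\<forall>x. P x = A (replicate n x)))"

definition form_of_polynomial ::
    "nat \<Rightarrow> ('a::complex_normed_vector \<Rightarrow> complex) \<Rightarrow> 'a list \<Rightarrow> complex"
  where "form_of_polynomial n P =
    (THE A. symmetric_form n A \<and> (\<forall>x. P x = A (replicate n x)))"

definition taylor_polynomials ::
    "('a::complex_normed_vector \<Rightarrow> complex) \<Rightarrow> nat \<Rightarrow> 'a \<Rightarrow> complex"
  where "taylor_polynomials f =
    (THE P. (\<forall>n. homogeneous_polynomial n (P n)) \<and>
      (\<exists>r>0. uniform_limit (ball 0 r) (\<lambda>N x. \<Sum>n<N. P n x) f sequentially))"


section \<open>The Aron--Berner extension\<close>

text \<open>The coarsest filter on the space along which the canonical image of the variable converges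
  weak-star to \<open>z\<close>: a net in the space converges weak-star to \<open>z\<close> iff its tail filter is below
  this one. By Goldstine's theorem it is a proper filter. Limits along it are therefore exactly
  the limits along all nets converging weak-star to \<open>z\<close>.\<close>

definition weak_star_filter :: "'a::complex_normed_vector cdual cdual \<Rightarrow> 'a filter"
  where "weak_star_filter z = (INF \<gamma>. filtercomap (cdual_apply \<gamma>) (nhds (cdual_apply z \<gamma>)))"

text \<open>The head of the list carries the outermost limit.\<close>

fun extend_form ::
    "('a::complex_normed_vector list \<Rightarrow> complex) \<Rightarrow> 'a cdual cdual list \<Rightarrow> complex"
  where
    "extend_form A [] = A []"
  | "extend_form A (z # zs) = Lim (weak_star_filter z) (\<lambda>x. extend_form (\<lambda>xs. A (x # xs)) zs)"

definition aron_berner ::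
    "('a::complex_normed_vector \<Rightarrow> complex) \<Rightarrow> 'a cdual cdual \<Rightarrow> complex"
  where "aron_berner f z =
    (\<Sum>n. extend_form (form_of_polynomial n (taylor_polynomials f n)) (replicate n z))"

definition bidual_translation ::
    "'a::complex_normed_vector cdual cdual \<Rightarrow> ('a \<Rightarrow> complex) \<Rightarrow> 'a \<Rightarrow> complex"
  where "bidual_translation z f = (\<lambda>x. aron_berner f (canonical_embedding x + z))"


section \<open>The weighted algebra and its spectrum\<close>

text \<open>A family of weights is indexed by the positive natural numbers; its value at \<open>0\<close> is never
  used.\<close>

definition HV :: "(nat \<Rightarrow> 'a::complex_normed_vector \<Rightarrow> real) \<Rightarrow> ('a \<Rightarrow> complex) set"
  where "HV v = {f. entire f \<and> (\<forall>n\<ge>1. bdd_above (range (\<lambda>x. v n x * cmod (f x))))}"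

definition weighted_norm ::
    "(nat \<Rightarrow> 'a::complex_normed_vector \<Rightarrow> real) \<Rightarrow> nat \<Rightarrow> ('a \<Rightarrow> complex) \<Rightarrow> real"
  where "weighted_norm v n f = (SUP x. v n x * cmod (f x))"

definition HV_topology ::
    "(nat \<Rightarrow> 'a::complex_normed_vector \<Rightarrow> real) \<Rightarrow> ('a \<Rightarrow> complex) topology"
  where "HV_topology v = topology_generated_by
    {{g \<in> HV v. weighted_norm v n (\<lambda>x. g x - f x) < r} |f n r. f \<in> HV v \<and> n \<ge> 1 \<and> r > 0}"

text \<open>Functionals on \<open>HV v\<close> are extensional, so that they are equal as soon as they agree on
  \<open>HV v\<close>.\<close>

definition spectrum ::
    "(nat \<Rightarrow> 'a::complex_normed_vector \<Rightarrow> real) \<Rightarrow> (('a \<Rightarrow> complex) \<Rightarrow> complex) set"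
  where "spectrum v = {\<phi> \<in> extensional (HV v).
    (\<forall>f\<in>HV v. \<forall>g\<in>HV v. \<phi> (\<lambda>x. f x + g x) = \<phi> f + \<phi> g) \<and>
    (\<forall>c. \<forall>f\<in>HV v. \<phi> (\<lambda>x. c * f x) = c * \<phi> f) \<and>
    (\<forall>f\<in>HV v. \<forall>g\<in>HV v. \<phi> (\<lambda>x. f x * g x) = \<phi> f * \<phi> g) \<and>
    (\<exists>f\<in>HV v. \<phi> f \<noteq> 0) \<and>
    continuous_map (HV_topology v) euclidean \<phi>}"

definition spectrum_proj ::
    "(('a::complex_normed_vector \<Rightarrow> complex) \<Rightarrow> complex) \<Rightarrow> 'a cdual cdual"
  where "spectrum_proj \<phi> = (THE z. \<forall>\<gamma>. cdual_apply z \<gamma> = \<phi> (cdual_apply \<gamma>))"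

definition spectrum_nbhd ::
    "(nat \<Rightarrow> 'a::complex_normed_vector \<Rightarrow> real) \<Rightarrow> (('a \<Rightarrow> complex) \<Rightarrow> complex) \<Rightarrow> real
      \<Rightarrow> (('a \<Rightarrow> complex) \<Rightarrow> complex) set"
  where "spectrum_nbhd v \<phi> \<epsilon> =
    {compose (HV v) \<phi> (bidual_translation z) |z. norm z < \<epsilon>}"

definition spectrum_sheet ::
    "(nat \<Rightarrow> 'a::complex_normed_vector \<Rightarrow> real) \<Rightarrow> (('a \<Rightarrow> complex) \<Rightarrow> complex)
      \<Rightarrow> (('a \<Rightarrow> complex) \<Rightarrow> complex) set"
  where "spectrum_sheet v \<phi> = (\<Union>\<epsilon>\<in>{0<..}. spectrum_nbhd v \<phi> \<epsilon>)"

definition holomorphic_on_spectrum ::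
    "(nat \<Rightarrow> 'a::complex_normed_vector \<Rightarrow> real) \<Rightarrow> ((('a \<Rightarrow> complex) \<Rightarrow> complex) \<Rightarrow> complex)
      \<Rightarrow> bool"
  where "holomorphic_on_spectrum v g \<longleftrightarrow>
    (\<forall>\<phi>\<in>spectrum v. entire (g \<circ> inv_into (spectrum_sheet v \<phi>) spectrum_proj))"

end

theory Submission
  imports Defs "HOL-Complex_Analysis.Cauchy_Integral_Formula"
begin

text \<open>On the sheet through \<open>\<phi>\<close> the function \<open>f''\<close> is \<open>w \<mapsto> \<phi> (x \<mapsto> F (J x + w))\<close> up to a translation,
  where \<open>F\<close> is the Aron--Berner extension of \<open>f\<close>. Expanding \<open>F\<close> to first order at \<open>J x + w\<close>, Cauchy's
  estimates on the unit ball bound the derivative by \<open>O(\<parallel>h\<parallel>)\<close> and the remainder by \<open>O(\<parallel>h\<parallel>\<^sup>2)\<close> in every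
  weighted norm, so the linear continuous \<open>\<phi>\<close> may be applied term by term. The bounds needed for \<open>F\<close> come
  from the Taylor series: the symmetric \<open>n\<close>-linear form of \<open>f\<close> is an iterated directional derivative, of
  norm at most \<open>(3 / R)\<^sup>n sup {\<bar>f y\<bar>. \<parallel>y\<parallel> \<le> R}\<close>, and the extension of forms to the bidual does not
  increase this norm.\<close>

section \<open>Complex-linear maps and directional derivatives\<close>

text \<open>The weak-star filter also admits unbounded nets, so an iterated limit exists only
  because the inner extension is, at every stage, a bounded linear functional of the variable.
  Boundedness and linearity therefore have to travel together through one induction. The derivative
  of the diagonal of an extended form is taken as the sum over its slots, so multilinearity and the
  norm bound are all that must survive the extension. The Taylor estimates are centred at the origin
  and enlarge the radius: 3 comes from n^n / n! \<le> e^n \<le> 3^n, and 6 = 2 * 3 makes the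
  extended series geometric with ratio 1/2. A bound for the extension on a ball thus costs a bound
  for \<open>f\<close> on a ball six times as large, which the same weight cannot supply. The
  condition \<eta> s * \<eta> t \<le> C * \<eta> (s + t), iterated, compares the sixth power of
  \<eta> s with \<eta> (6 * s), so passing from \<open>v n\<close> to \<open>v (6 * n)\<close> pays
  for the dilation.\<close>

lemma clinear_add: "clinear f \<Longrightarrow> f (x + y) = f x + f y"
  and clinear_scaleC: "clinear f \<Longrightarrow> f (c *\<^sub>C x) = c *\<^sub>C f x"
  by (auto simp: clinear_def)

lemma scaleC_one [simp]: "1 *\<^sub>C x = (x :: 'a::complex_normed_vector)"
  using scaleC_of_real[of 1 x] by simp

lemma scaleC_zero_left [simp]: "0 *\<^sub>C x = (0 :: 'a::complex_normed_vector)"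
  using scaleC_of_real[of 0 x] by simp

lemma scaleC_zero_right [simp]: "c *\<^sub>C (0 :: 'a::complex_normed_vector) = 0"
  using scaleC_add_right[of c 0 0] by simp

lemma scaleC_minus_one: "(-1) *\<^sub>C x = - (x :: 'a::complex_normed_vector)"
  using scaleC_of_real[of "-1" x] by simp

lemma clinear_zero: "clinear f \<Longrightarrow> f 0 = 0"
  using clinear_scaleC[of f 0 0] by simp

lemma clinear_minus: "clinear f \<Longrightarrow> f (- x) = - f x"
  using clinear_scaleC[of f "-1" x] by (simp add: scaleC_minus_one)

lemma clinear_diff: "clinear f \<Longrightarrow> f (x - y) = f x - f y"
  using clinear_add[of f x "- y"] by (simp add: clinear_minus)

lemma clinear_bounded_linear:
  assumes "clinear f" "\<And>x. norm (f x) \<le> K * norm x"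
  shows "bounded_linear f"
proof (rule bounded_linear_intro[where K = K])
  show "f (r *\<^sub>R x) = r *\<^sub>R f x" for r x
    using clinear_scaleC[OF assms(1), of "complex_of_real r" x] by (simp add: scaleC_of_real)
qed (use assms in \<open>auto simp: clinear_add mult.commute\<close>)

lemma bounded_linear_scaleC_left: "bounded_linear (\<lambda>c. c *\<^sub>C (x :: 'a::complex_normed_vector))"
proof (rule bounded_linear_intro[where K = "norm x"])
  show "(r *\<^sub>R c) *\<^sub>C x = r *\<^sub>R (c *\<^sub>C x)" for r c
    by (simp add: scaleR_conv_of_real scaleC_scaleC flip: scaleC_of_real)
qed (auto simp: scaleC_add_left norm_scaleC)

text \<open>A one-variable derivative along a complex line, so that complex analysis in the plane
  applies. As a total function it can be iterated without choosing Frechet derivatives.\<close>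

definition ddir :: "'a::complex_normed_vector \<Rightarrow> ('a \<Rightarrow> complex) \<Rightarrow> 'a \<Rightarrow> complex"
  where "ddir h f x = deriv (\<lambda>t. f (x + t *\<^sub>C h)) 0"

lemma has_field_derivative_line:
  assumes "(f has_derivative D) (at (x + t *\<^sub>C h))" "clinear D"
  shows "((\<lambda>t. f (x + t *\<^sub>C h)) has_field_derivative D h) (at t)"
proof -
  have "((\<lambda>t. x + t *\<^sub>C h) has_derivative (\<lambda>s. s *\<^sub>C h)) (at t)"
    by (auto intro!: derivative_eq_intros bounded_linear_imp_has_derivative
        bounded_linear_scaleC_left)
  from diff_chain_at[OF this assms(1)]
  have "((\<lambda>t. f (x + t *\<^sub>C h)) has_derivative (\<lambda>s. D (s *\<^sub>C h))) (at t)"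
    by (simp add: o_def)
  then show ?thesis
    using assms(2) by (simp add: has_field_derivative_def clinear_def scaleC_complex_def
        mult.commute[of _ "D h"])
qed

text \<open>The chain rule along complex lines identifies any complex-linear Frechet derivative, so
  \<open>ddir\<close> replaces the existential in \<open>entire\<close> from here on.\<close>

lemma has_derivative_ddir:
  assumes "entire f"
  shows "(f has_derivative (\<lambda>h. ddir h f x)) (at x)" "clinear (\<lambda>h. ddir h f x)"
proof -
  obtain D where D: "(f has_derivative D) (at x)" "clinear D"
    using assms unfolding entire_def by blast
  have "ddir h f x = D h" for h
    unfolding ddir_def
    by (rule DERIV_imp_deriv, rule has_field_derivative_line) (use D in auto)
  then have "(\<lambda>h. ddir h f x) = D"
    by auto
  with D show "(f has_derivative (\<lambda>h. ddir h f x)) (at x)" "clinear (\<lambda>h. ddir h f x)"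
    by auto
qed

lemma entire_has_field_derivative_line:
  assumes "entire f"
  shows "((\<lambda>t. f (x + t *\<^sub>C h)) has_field_derivative ddir h f (x + t *\<^sub>C h)) (at t)"
  by (rule has_field_derivative_line) (use has_derivative_ddir[OF assms] in auto)

lemma entire_holomorphic_line: "entire f \<Longrightarrow> (\<lambda>t. f (x + t *\<^sub>C h)) holomorphic_on S"
  using entire_has_field_derivative_line field_differentiable_at_within
  unfolding holomorphic_on_def field_differentiable_def by blast

lemma entire_continuous: "entire f \<Longrightarrow> isCont f x"
  using has_derivative_ddir(1) has_derivative_continuous by blast

lemma entire_locally_bounded:
  assumes "entire f"
  obtains r where "r > 0" "\<And>y. norm (y - x) \<le> r \<Longrightarrow> cmod (f y) \<le> cmod (f x) + 1"
proof -
  obtain d where d: "d > 0" "\<And>y. dist y x < d \<Longrightarrow> dist (f y) (f x) < 1"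
    using entire_continuous[OF assms, of x] unfolding continuous_at_eps_delta
    by (meson zero_less_one)
  have "cmod (f y) \<le> cmod (f x) + 1" if "norm (y - x) \<le> d/2" for y
    using d(2)[of y] d(1) that norm_triangle_sub[of "f y" "f x"] by (auto simp: dist_norm)
  then show ?thesis
    using that[of "d/2"] d(1) by simp
qed

lemma entire_add:
  assumes "entire f" "entire g"
  shows "entire (\<lambda>x. f x + g x)" "ddir h (\<lambda>x. f x + g x) x = ddir h f x + ddir h g x"
proof -
  show "entire (\<lambda>x. f x + g x)"
    unfolding entire_def
  proof
    fix x
    show "\<exists>D. ((\<lambda>x. f x + g x) has_derivative D) (at x) \<and> clinear D"
      using has_derivative_ddir[OF assms(1), of x] has_derivative_ddir[OF assms(2), of x]
      by (intro exI[of _ "\<lambda>h. ddir h f x + ddir h g x"] conjI has_derivative_add)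
        (auto simp: clinear_def scaleC_complex_def algebra_simps)
  qed
  show "ddir h (\<lambda>x. f x + g x) x = ddir h f x + ddir h g x"
    unfolding ddir_def[of h "\<lambda>x. f x + g x"]
    using entire_has_field_derivative_line[OF assms(1), of x h 0]
      entire_has_field_derivative_line[OF assms(2), of x h 0]
    by (intro DERIV_imp_deriv derivative_eq_intros) auto
qed

lemma entire_cmult:
  assumes "entire f"
  shows "entire (\<lambda>x. c * f x)" "ddir h (\<lambda>x. c * f x) x = c * ddir h f x"
proof -
  show "entire (\<lambda>x. c * f x)"
    unfolding entire_def
  proof
    fix x
    show "\<exists>D. ((\<lambda>x. c * f x) has_derivative D) (at x) \<and> clinear D"
      using has_derivative_ddir[OF assms(1), of x]
      by (intro exI[of _ "\<lambda>h. c * ddir h f x"] conjI has_derivative_mult_right)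
        (auto simp: clinear_def scaleC_complex_def algebra_simps)
  qed
  show "ddir h (\<lambda>x. c * f x) x = c * ddir h f x"
    unfolding ddir_def[of h "\<lambda>x. c * f x"]
    using entire_has_field_derivative_line[OF assms(1), of x h 0]
    by (intro DERIV_imp_deriv DERIV_cmult) auto
qed

lemma entire_diff:
  assumes "entire f" "entire g"
  shows "entire (\<lambda>x. f x - g x)" "ddir h (\<lambda>x. f x - g x) x = ddir h f x - ddir h g x"
  using entire_add[OF assms(1) entire_cmult(1)[OF assms(2), of "-1"]]
    entire_cmult(2)[OF assms(2), of h "-1" x] by auto

lemma entire_const: "entire (\<lambda>x. c)"
  unfolding entire_def by (auto intro!: exI[of _ "\<lambda>_. 0"] simp: clinear_def)

lemma entire_sum:
  assumes "\<And>i. i \<in> I \<Longrightarrow> entire (f i)"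
  shows "entire (\<lambda>x. \<Sum>i\<in>I. f i x)"
  using assms by (induction I rule: infinite_finite_induct) (auto intro: entire_const entire_add)

lemma entire_compose_affine:
  assumes "entire f" "bounded_linear L" "clinear L"
  shows "entire (\<lambda>x. f (L x + a))"
  unfolding entire_def
proof
  fix x
  have "((\<lambda>x. L x + a) has_derivative L) (at x)"
    using assms(2) by (auto intro!: derivative_eq_intros bounded_linear_imp_has_derivative)
  from diff_chain_at[OF this has_derivative_ddir(1)[OF assms(1)]]
  show "\<exists>D. ((\<lambda>x. f (L x + a)) has_derivative D) (at x) \<and> clinear D"
    using has_derivative_ddir(2)[OF assms(1), of "L x + a"] assms(3)
    by (intro exI[of _ "\<lambda>h. ddir (L h) f (L x + a)"]) (auto simp: o_def clinear_def)
qed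

lemma entire_translate:
  assumes "entire f"
  shows "entire (\<lambda>x. f (x + a))" "ddir h (\<lambda>x. f (x + a)) x = ddir h f (x + a)"
  using entire_compose_affine[OF assms, of "\<lambda>x. x" a]
  by (auto simp: clinear_def ddir_def algebra_simps)

section \<open>Cauchy estimates\<close>

text \<open>On the line through \<open>x\<close> in direction \<open>h\<close> the ball of radius
  \<open>r\<close> becomes the disc of radius \<open>r / norm h\<close>, where Cauchy's inequality
  for the first derivative applies.\<close>

lemma Cauchy_ddir:
  assumes "entire f" "r > 0" "\<And>y. norm (y - x) \<le> r \<Longrightarrow> cmod (f y) \<le> M"
  shows "cmod (ddir h f x) \<le> M * norm h / r"
proof (cases "h = 0")
  case True
  then show ?thesis
    using has_derivative_ddir(2)[OF assms(1), of x] clinear_zero by fastforce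
next
  case False
  define R where "R = r / norm h"
  have R: "R > 0"
    using False assms(2) by (simp add: R_def)
  have "norm ((deriv ^^ 1) (\<lambda>t. f (x + t *\<^sub>C h)) 0) \<le> fact 1 * M / R ^ 1"
  proof (rule Cauchy_inequality)
    show "continuous_on (cball 0 R) (\<lambda>t. f (x + t *\<^sub>C h))"
      using entire_holomorphic_line[OF assms(1)] holomorphic_on_imp_continuous_on by blast
    show "cmod (f (x + t *\<^sub>C h)) \<le> M" if "cmod (0 - t) = R" for t
      using that False by (intro assms(3)) (simp add: norm_scaleC R_def)
  qed (use R entire_holomorphic_line[OF assms(1)] in auto)
  then show ?thesis
    by (simp add: ddir_def R_def field_simps)
qed

text \<open>First-order Taylor formula for t from 0 to 1 on the line. Since
  \<open>norm h \<le> r / 2\<close>, the disc of radius \<open>R = r / norm h\<close> has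
  \<open>R \<ge> 2\<close>, so discs of radius R/2 about points of the unit disc stay inside it;
  Cauchy's inequality bounds the second derivative by 2 * M / (R/2)^2, whence the 8.\<close>

lemma Cauchy_remainder:
  assumes "entire f" "r > 0" "\<And>y. norm (y - x) \<le> r \<Longrightarrow> cmod (f y) \<le> M" "norm h \<le> r / 2"
  shows "cmod (f (x + h) - f x - ddir h f x) \<le> 8 * M * (norm h)\<^sup>2 / r\<^sup>2"
proof (cases "h = 0")
  case True
  then show ?thesis
    using has_derivative_ddir(2)[OF assms(1), of x] clinear_zero by fastforce
next
  case False
  define g where "g = (\<lambda>t. f (x + t *\<^sub>C h))"
  define R where "R = r / norm h"
  have R: "R \<ge> 2"
    using False assms(4) by (simp add: R_def field_simps)
  have hol: "g holomorphic_on S" for S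
    unfolding g_def by (rule entire_holomorphic_line[OF assms(1)])
  have bound: "cmod ((deriv ^^ 2) g t) \<le> 8 * M / R\<^sup>2" if t: "t \<in> cball 0 1" for t
  proof -
    have "norm ((deriv ^^ 2) g t) \<le> fact 2 * M / (R/2) ^ 2"
    proof (rule Cauchy_inequality)
      show "cmod (g s) \<le> M" if "cmod (t - s) = R/2" for s
      proof -
        have "cmod s \<le> R"
          using that t R norm_triangle_ineq4[of t "t - s"] by simp
        then show ?thesis
          unfolding g_def using False
          by (intro assms(3)) (simp add: norm_scaleC R_def field_simps)
      qed
    qed (use R hol holomorphic_on_imp_continuous_on in auto)
    then show ?thesis
      by (simp add: power2_eq_square field_simps)
  qed
  have deriv: "((deriv ^^ i) g has_field_derivative (deriv ^^ Suc i) g t) (at t within S)" for i t S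
    using holomorphic_derivI[OF holomorphic_higher_deriv[OF hol open_UNIV, of i], of t]
    by (simp add: has_field_derivative_at_within)
  have bound': "cmod ((deriv ^^ Suc 1) g t) \<le> 8 * M / R\<^sup>2" if "t \<in> cball 0 1" for t
    using bound[OF that] by (simp add: numeral_2_eq_2)
  have "cmod ((deriv ^^ 0) g 1 - (\<Sum>i\<le>1. (deriv ^^ i) g 0 * (1 - 0) ^ i / fact i))
      \<le> 8 * M / R\<^sup>2 * cmod (1 - 0) ^ Suc 1 / fact 1"
    by (rule complex_Taylor[of "cball 0 1" 1 "\<lambda>i. (deriv ^^ i) g"])
      (use deriv bound' in auto)
  then have "cmod (g 1 - g 0 - deriv g 0) \<le> 8 * M / R\<^sup>2"
    by (simp add: diff_diff_eq)
  then show ?thesis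
    by (simp add: g_def ddir_def R_def power_divide)
qed

section \<open>Locally uniform limits\<close>

text \<open>The criterion behind each Frechet derivative that is built by hand below: for locally
  uniform limits, for diagonals of multilinear forms, and for \<phi> applied to translates.\<close>

lemma has_derivative_quadratic:
  fixes f :: "'a::real_normed_vector \<Rightarrow> 'b::real_normed_vector"
  assumes D: "bounded_linear D" and d: "d > 0"
    and rem: "\<And>h. norm h \<le> d \<Longrightarrow> norm (f (x + h) - f x - D h) \<le> K * (norm h)\<^sup>2"
  shows "(f has_derivative D) (at x)"
  unfolding has_derivative_at
proof (intro conjI D)
  have "((\<lambda>h :: 'a. \<bar>K\<bar> * norm h) \<longlongrightarrow> 0) (at 0)"
    by (intro tendsto_mult_right_zero tendsto_norm_zero tendsto_ident_at)
  then show "(\<lambda>h. norm (f (x + h) - f x - D h) / norm h) \<midarrow>0\<rightarrow> 0"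
  proof (rule Lim_null_comparison[rotated])
    show "\<forall>\<^sub>F h in at 0. norm (norm (f (x + h) - f x - D h) / norm h) \<le> \<bar>K\<bar> * norm h"
      unfolding eventually_at
    proof (intro exI[of _ d] conjI d ballI impI)
      fix h :: 'a assume h: "h \<noteq> 0 \<and> dist h 0 < d"
      then have "norm (f (x + h) - f x - D h) \<le> \<bar>K\<bar> * (norm h)\<^sup>2"
        using order_trans[OF rem[of h] mult_right_mono[OF abs_ge_self[of K]]] by simp
      then show "norm (norm (f (x + h) - f x - D h) / norm h) \<le> \<bar>K\<bar> * norm h"
        using h by (simp add: field_simps power2_eq_square)
    qed
  qed
qed

text \<open>Weierstrass' theorem in a normed space. Cauchy's estimate for differences makes the
  directional derivatives converge, and the quadratic remainder bound, being uniform in n, survives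
  the pointwise limit; so the convergence of derivatives is needed at \<open>x\<close>
  alone.\<close>

lemma entire_ddir_uniform_limit:
  fixes F :: "nat \<Rightarrow> 'a::complex_normed_vector \<Rightarrow> complex"
  assumes ent: "\<And>n. entire (F n)"
    and r: "r > 0" and lim: "uniform_limit (cball x r) F f sequentially"
  shows "\<exists>D. (f has_derivative D) (at x) \<and> clinear D \<and> (\<forall>h. (\<lambda>n. ddir h (F n) x) \<longlonglongrightarrow> D h)"
proof -
  have lim': "\<exists>N. \<forall>n\<ge>N. \<forall>y\<in>cball x r. cmod (F n y - f y) < e" if "e > 0" for e
    using uniform_limitD[OF lim that] by (simp add: eventually_sequentially dist_norm)
  have Cauchy: "Cauchy (\<lambda>n. ddir h (F n) x)" for h
  proof (rule CauchyI)
    fix e :: real assume e: "e > 0"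
    \<comment> \<open>Cauchy's estimate turns closeness \<open>2 * d\<close> of values into
      \<open>2 * d * norm h / r\<close> for derivatives; the added 1 covers
      \<open>h = 0\<close>.\<close>
    define d where "d = e * r / (4 * (norm h + 1))"
    have d: "d > 0"
      using e r by (simp add: d_def add_nonneg_pos)
    obtain N where N: "\<And>n y. n \<ge> N \<Longrightarrow> y \<in> cball x r \<Longrightarrow> cmod (F n y - f y) < d"
      using lim'[OF d] by blast
    have "cmod (ddir h (F m) x - ddir h (F n) x) < e" if mn: "m \<ge> N" "n \<ge> N" for m n
    proof -
      have "cmod (F m y - F n y) \<le> 2 * d" if "norm (y - x) \<le> r" for y
        using N[OF mn(1), of y] N[OF mn(2), of y] that
          norm_triangle_ineq4[of "F m y - f y" "F n y - f y"]
        by (simp add: dist_norm norm_minus_commute)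
      from Cauchy_ddir[OF entire_diff(1)[OF ent ent] r this, where h = h]
      have "cmod (ddir h (F m) x - ddir h (F n) x) \<le> 2 * d * norm h / r"
        by (simp add: entire_diff(2)[OF ent ent])
      also have "\<dots> = (e / 2) * (norm h / (norm h + 1))"
        using r add_nonneg_pos[of "norm h" 1] by (simp add: d_def divide_simps)
      also have "\<dots> \<le> (e / 2) * 1"
        using e add_nonneg_pos[of "norm h" 1] by (intro mult_left_mono) (auto simp: divide_le_eq)
      also have "\<dots> < e"
        using e by simp
      finally show ?thesis .
    qed
    then show "\<exists>N. \<forall>m\<ge>N. \<forall>n\<ge>N. norm (ddir h (F m) x - ddir h (F n) x) < e"
      by blast
  qed
  define D where "D h = lim (\<lambda>n. ddir h (F n) x)" for h
  have D: "(\<lambda>n. ddir h (F n) x) \<longlonglongrightarrow> D h" for h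
    using Cauchy[of h] unfolding D_def by (simp add: Cauchy_convergent convergent_LIMSEQ_iff[symmetric])
  have lin: "clinear D"
    unfolding clinear_def
  proof (intro conjI allI)
    fix h k c
    have "(\<lambda>n. ddir (h + k) (F n) x) = (\<lambda>n. ddir h (F n) x + ddir k (F n) x)"
      using clinear_add[OF has_derivative_ddir(2)[OF ent]] by auto
    then show "D (h + k) = D h + D k"
      using D[of "h + k"] tendsto_add[OF D[of h] D[of k]] LIMSEQ_unique by auto
    have "(\<lambda>n. ddir (c *\<^sub>C h) (F n) x) = (\<lambda>n. c * ddir h (F n) x)"
      using clinear_scaleC[OF has_derivative_ddir(2)[OF ent]] by (auto simp: scaleC_complex_def)
    then show "D (c *\<^sub>C h) = c *\<^sub>C D h"
      using D[of "c *\<^sub>C h"] tendsto_mult_left[OF D[of h], of c] LIMSEQ_unique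
      by (auto simp: scaleC_complex_def)
  qed
  \<comment> \<open>From index N on, all functions stay within 2 of \<open>F N\<close>, which is
    bounded near \<open>x\<close> by continuity only: closed balls need not be compact, so the
    radius shrinks to \<open>q\<close>. The 3 in \<open>M\<close> is 1 from this local bound plus
    2.\<close>
  obtain N where N: "\<And>n y. n \<ge> N \<Longrightarrow> y \<in> cball x r \<Longrightarrow> cmod (F n y - f y) < 1"
    using lim'[of 1] zero_less_one by blast
  obtain s where s: "s > 0" "\<And>y. norm (y - x) \<le> s \<Longrightarrow> cmod (F N y) \<le> cmod (F N x) + 1"
    using entire_locally_bounded[OF ent] by blast
  define q where "q = min r s"
  define M where "M = cmod (F N x) + 3"
  have q: "q > 0" "q \<le> r" "q \<le> s"
    using r s by (auto simp: q_def)
  have bound: "cmod (F n y) \<le> M" if "n \<ge> N" "norm (y - x) \<le> q" for n y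
  proof -
    have "cmod (F n y - F N y) \<le> 2"
      using N[OF that(1), of y] N[of N y] that q
        norm_triangle_ineq4[of "F n y - f y" "F N y - f y"]
      by (simp add: dist_norm norm_minus_commute)
    then show ?thesis
      using s(2)[of y] that q norm_triangle_sub[of "F n y" "F N y"] by (simp add: M_def)
  qed
  have pt: "(\<lambda>n. F n y) \<longlonglongrightarrow> f y" if "norm (y - x) \<le> r" for y
    using tendsto_uniform_limitI[OF lim, of y] that by (simp add: dist_norm norm_minus_commute)
  have D_le: "cmod (D h) \<le> M / q * norm h" for h
  proof (rule tendsto_upperbound[OF tendsto_norm[OF D]])
    show "\<forall>\<^sub>F n in sequentially. cmod (ddir h (F n) x) \<le> M / q * norm h"
      using Cauchy_ddir[OF ent q(1) bound, where h = h]
      by (auto simp: eventually_sequentially intro!: exI[of _ N])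
  qed simp
  have rem: "cmod (f (x + h) - f x - D h) \<le> 8 * M * (norm h)\<^sup>2 / q\<^sup>2" if h: "norm h \<le> q / 2" for h
  proof (rule tendsto_upperbound)
    show "(\<lambda>n. cmod (F n (x + h) - F n x - ddir h (F n) x)) \<longlonglongrightarrow> cmod (f (x + h) - f x - D h)"
      using h q r by (intro tendsto_intros pt D) auto
    show "\<forall>\<^sub>F n in sequentially. cmod (F n (x + h) - F n x - ddir h (F n) x)
        \<le> 8 * M * (norm h)\<^sup>2 / q\<^sup>2"
      using Cauchy_remainder[OF ent q(1) bound, where h = h] h
      by (auto simp: eventually_sequentially intro!: exI[of _ N])
  qed simp
  have "(f has_derivative D) (at x)"
  proof (rule has_derivative_quadratic[OF clinear_bounded_linear[OF lin D_le]])
    show "q / 2 > 0"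
      using q by simp
    show "cmod (f (x + h) - f x - D h) \<le> 8 * M / q\<^sup>2 * (norm h)\<^sup>2" if "norm h \<le> q / 2" for h
      using rem[OF that] by simp
  qed
  with lin D show ?thesis
    by blast
qed

lemma entire_uniform_limit:
  fixes F :: "nat \<Rightarrow> 'a::complex_normed_vector \<Rightarrow> complex"
  assumes ent: "\<And>n. entire (F n)"
    and lim: "\<And>x. \<exists>r>0. uniform_limit (cball x r) F f sequentially"
  shows "entire f" "(\<lambda>n. ddir h (F n) x) \<longlonglongrightarrow> ddir h f x"
proof -
  have ex: "\<exists>D. (f has_derivative D) (at x) \<and> clinear D \<and> (\<forall>h. (\<lambda>n. ddir h (F n) x) \<longlonglongrightarrow> D h)"
    for x
    using lim[of x] entire_ddir_uniform_limit[of F, OF ent] by blast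
  then show *: "entire f"
    unfolding entire_def by blast
  obtain D where D: "(f has_derivative D) (at x)" "\<And>h. (\<lambda>n. ddir h (F n) x) \<longlonglongrightarrow> D h"
    using ex by blast
  have "D = (\<lambda>h. ddir h f x)"
    using has_derivative_unique[OF D(1) has_derivative_ddir(1)[OF *]] .
  with D(2) show "(\<lambda>n. ddir h (F n) x) \<longlonglongrightarrow> ddir h f x"
    by simp
qed

section \<open>Difference quotients: directional derivatives are entire and commute\<close>

definition diff_quotient ::
    "'a::complex_normed_vector \<Rightarrow> nat \<Rightarrow> ('a \<Rightarrow> complex) \<Rightarrow> 'a \<Rightarrow> complex"
  where "diff_quotient h n f y = of_nat (Suc n) * (f (y + inverse (of_nat (Suc n)) *\<^sub>C h) - f y)"

lemma entire_diff_quotient: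
  assumes "entire f"
  shows "entire (diff_quotient h n f)"
    and "ddir k (diff_quotient h n f) x = diff_quotient h n (ddir k f) x"
proof -
  have eq: "diff_quotient h n f =
      (\<lambda>y. of_nat (Suc n) * (f (y + inverse (of_nat (Suc n)) *\<^sub>C h) - f y))"
    by (auto simp: diff_quotient_def)
  note tr = entire_translate[OF assms, where a = "inverse (of_nat (Suc n)) *\<^sub>C h"]
  show "entire (diff_quotient h n f)"
    unfolding eq by (intro entire_cmult(1) entire_diff(1) tr(1) assms)
  show "ddir k (diff_quotient h n f) x = diff_quotient h n (ddir k f) x"
    unfolding eq entire_cmult(2)[OF entire_diff(1)[OF tr(1) assms]] entire_diff(2)[OF tr(1) assms]
      tr(2) by (simp add: diff_quotient_def)
qed

text \<open>\<open>Cauchy_remainder\<close> holds with the same \<open>M\<close> and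
  \<open>r\<close> at every point of a small ball; divided by the step length it leaves an error
  proportional to the step. Halving \<open>s\<close> keeps the balls about these points inside the
  region where \<open>f\<close> is bounded.\<close>

lemma uniform_limit_diff_quotient:
  assumes f: "entire f"
  shows "\<exists>r>0. uniform_limit (cball x r) (\<lambda>n. diff_quotient h n f) (ddir h f) sequentially"
proof -
  define c where "c n = inverse (of_nat (Suc n) :: complex)" for n
  define Q where "Q n = diff_quotient h n f" for n
  have c: "c n \<noteq> 0" "cmod (c n) = inverse (real (Suc n))" for n
    by (simp_all add: c_def norm_inverse del: of_nat_Suc)
  have Q_eq: "Q n y = (f (y + c n *\<^sub>C h) - f y) / c n" for n y
    by (simp add: Q_def c_def diff_quotient_def divide_inverse del: of_nat_Suc)
  have c0: "(\<lambda>n. inverse (real (Suc n)) * K) \<longlonglongrightarrow> 0" for K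
  by (rule tendsto_mult_left_zero[OF LIMSEQ_inverse_real_of_nat])
  obtain s where s: "s > 0" "\<And>y. norm (y - x) \<le> s \<Longrightarrow> cmod (f y) \<le> cmod (f x) + 1"
    using entire_locally_bounded[OF f] by blast
  define r where "r = s / 2"
  define M where "M = cmod (f x) + 1"
  have r: "r > 0"
    using s by (simp add: r_def)
  have M: "cmod (f z) \<le> M" if "y \<in> cball x r" "norm (z - y) \<le> r" for y z
    using that s(2)[of z] norm_triangle_ineq[of "z - y" "y - x"]
    by (simp add: r_def M_def dist_norm norm_minus_commute)
  have "uniform_limit (cball x r) Q (ddir h f) sequentially"
  proof (rule uniform_limitI)
    fix e :: real assume e: "e > 0"
    have "\<forall>\<^sub>F n in sequentially. inverse (real (Suc n)) * norm h < r / 2"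
      using order_tendstoD(2)[OF c0, of "r / 2"] r by simp
    moreover have "\<forall>\<^sub>F n in sequentially. inverse (real (Suc n)) * (8 * M * (norm h)\<^sup>2 / r\<^sup>2) < e"
      using order_tendstoD(2)[OF c0 e] .
    ultimately show "\<forall>\<^sub>F n in sequentially. \<forall>y\<in>cball x r. dist (Q n y) (ddir h f y) < e"
    proof eventually_elim
      case (elim n)
      show ?case
      proof
        fix y assume y: "y \<in> cball x r"
        have "cmod (f (y + c n *\<^sub>C h) - f y - ddir (c n *\<^sub>C h) f y)
            \<le> 8 * M * (norm (c n *\<^sub>C h))\<^sup>2 / r\<^sup>2"
          using elim c(2)[of n] by (intro Cauchy_remainder[OF f r M[OF y]]) (auto simp: norm_scaleC)
        then have "cmod (f (y + c n *\<^sub>C h) - f y - c n * ddir h f y) / cmod (c n)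
            \<le> (8 * M * (norm (c n *\<^sub>C h))\<^sup>2 / r\<^sup>2) / cmod (c n)"
          using clinear_scaleC[OF has_derivative_ddir(2)[OF f]]
          by (intro divide_right_mono) (auto simp: scaleC_complex_def)
        also have "\<dots> = cmod (c n) * (8 * M * (norm h)\<^sup>2 / r\<^sup>2)"
          using c(1)[of n] by (simp add: norm_scaleC power2_eq_square)
        also have "\<dots> < e"
          using elim c(2)[of n] by simp
        also have "cmod (f (y + c n *\<^sub>C h) - f y - c n * ddir h f y) / cmod (c n)
            = dist (Q n y) (ddir h f y)"
          using c(1)[of n] by (simp add: Q_eq dist_norm field_simps flip: norm_divide)
        finally show "dist (Q n y) (ddir h f y) < e" .
      qed
    qed
  qed
  with r show ?thesis
    unfolding Q_def by blast
qed

lemma entire_ddir: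
  assumes "entire f"
  shows "entire (ddir h f)"
  using entire_uniform_limit(1)[OF entire_diff_quotient(1)[OF assms]
      uniform_limit_diff_quotient[OF assms]] .

text \<open>The difference quotients of \<open>ddir k f\<close> in direction \<open>h\<close> have
  both sides as limits: directly, and because \<open>ddir k\<close> may be exchanged first with the
  quotient and then with the locally uniform limit.\<close>

lemma ddir_commute:
  assumes "entire f"
  shows "ddir k (ddir h f) = ddir h (ddir k f)"
proof
  fix x
  have "(\<lambda>n. diff_quotient h n (ddir k f) x) \<longlonglongrightarrow> ddir k (ddir h f) x"
    using entire_uniform_limit(2)[OF entire_diff_quotient(1)[OF assms]
        uniform_limit_diff_quotient[OF assms], of k h x]
    by (simp add: entire_diff_quotient(2)[OF assms])
  moreover obtain r where "r > 0"
    "uniform_limit (cball x r) (\<lambda>n. diff_quotient h n (ddir k f)) (ddir h (ddir k f)) sequentially"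
    using uniform_limit_diff_quotient[OF entire_ddir[OF assms]] by blast
  then have "(\<lambda>n. diff_quotient h n (ddir k f) x) \<longlonglongrightarrow> ddir h (ddir k f) x"
    using tendsto_uniform_limitI by fastforce
  ultimately show "ddir k (ddir h f) x = ddir h (ddir k f) x"
    by (rule LIMSEQ_unique)
qed

section \<open>Iterated directional derivatives\<close>

lemma entire_foldr_ddir: "entire f \<Longrightarrow> entire (foldr ddir hs f)"
  by (induction hs) (auto intro: entire_ddir)

lemma foldr_ddir_mset:
  assumes f: "entire f" and "mset hs = mset ks"
  shows "foldr ddir hs f = foldr ddir ks f"
proof -
  have move: "foldr ddir (as @ h # bs) f = ddir h (foldr ddir (as @ bs) f)" for as bs h
  proof (induction as)
    case (Cons a as)
    then show ?case
      using ddir_commute[OF entire_foldr_ddir[OF f], of a h "as @ bs"]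
      by (simp del: foldr_append)
  qed simp
  show ?thesis
    using assms(2)
  proof (induction hs arbitrary: ks)
    case (Cons h hs)
    then have "h \<in> set ks"
      by (metis list.set_intros(1) set_mset_mset)
    then obtain as bs where ks: "ks = as @ h # bs"
      by (meson split_list)
    with Cons.prems have "mset hs = mset (as @ bs)"
      by simp
    from Cons.IH[OF this] show ?case
      using move[of as h bs] by (simp add: ks)
  qed simp
qed

text \<open>By symmetry the i-th direction can be made the outermost derivative, which is linear in
  its direction.\<close>

lemma clinear_foldr_ddir:
  assumes f: "entire f" and i: "i < length hs"
  shows "clinear (\<lambda>h. foldr ddir (hs[i := h]) f x)"
proof -
  have "mset (hs[i := h]) = mset (h # take i hs @ drop (Suc i) hs)" for h
    using i by (simp add: upd_conv_take_nth_drop)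
  then have "foldr ddir (hs[i := h]) f = ddir h (foldr ddir (take i hs @ drop (Suc i) hs) f)" for h
    using foldr_ddir_mset[OF f] by (metis foldr.simps(2) o_apply)
  then show ?thesis
    using has_derivative_ddir(2)[OF entire_foldr_ddir[OF f]] by (simp del: foldr_append)
qed

text \<open>Each derivative spends one step \<open>r\<close> of radius in a Cauchy estimate, hence
  the radius \<open>length hs * r\<close> on which \<open>f\<close> must be bounded.\<close>

lemma cmod_foldr_ddir_le:
  assumes f: "entire f" and r: "r > 0"
    and M: "\<And>y. norm (y - x) \<le> real (length hs) * r \<Longrightarrow> cmod (f y) \<le> M"
  shows "cmod (foldr ddir hs f x) \<le> M * prod_list (map norm hs) / r ^ length hs"
  using M
proof (induction hs arbitrary: x)
  case (Cons h hs)
  have "cmod (foldr ddir hs f y) \<le> M * prod_list (map norm hs) / r ^ length hs"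
    if y: "norm (y - x) \<le> r" for y
  proof (rule Cons.IH, rule Cons.prems)
    fix z assume "norm (z - y) \<le> real (length hs) * r"
    then show "norm (z - x) \<le> real (length (h # hs)) * r"
      using y norm_triangle_ineq[of "z - y" "y - x"] by (simp add: algebra_simps)
  qed
  from Cauchy_ddir[OF entire_foldr_ddir[OF f] r this, where h = h] show ?case
    by (simp add: mult_ac)
qed simp

text \<open>Stated along the whole line rather than at the origin because the induction step
  differentiates in \<open>t\<close>.\<close>

lemma foldr_ddir_replicate:
  "foldr ddir (replicate n x) f (t *\<^sub>C x) = (deriv ^^ n) (\<lambda>s. f (s *\<^sub>C x)) t"
proof (induction n arbitrary: t)
  case (Suc n)
  have "foldr ddir (replicate (Suc n) x) f (t *\<^sub>C x)
      = deriv (\<lambda>s. foldr ddir (replicate n x) f ((t + s) *\<^sub>C x)) 0"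
    by (simp add: ddir_def[of x "foldr ddir (replicate n x) f"] scaleC_add_left
        del: foldr_replicate)
  then show ?case
    using deriv_shift_0[of "(deriv ^^ n) (\<lambda>s. f (s *\<^sub>C x))" t]
    unfolding Suc.IH by (simp add: o_def)
qed simp

section \<open>Multilinear forms\<close>

text \<open>Differs from \<open>symmetric_form\<close> in carrying the constant \<open>K\<close>
  explicitly, since the later estimates need its size, and in asking only for what passes to slices
  and to the bidual by iterated limits.\<close>

definition multilinear_form ::
    "nat \<Rightarrow> real \<Rightarrow> ('a::complex_normed_vector list \<Rightarrow> complex) \<Rightarrow> bool"
  where "multilinear_form n K A \<longleftrightarrow>
    (\<forall>xs i. length xs = n \<and> i < n \<longrightarrow> clinear (\<lambda>x. A (xs[i := x]))) \<and>
    (\<forall>xs. length xs = n \<longrightarrow> cmod (A xs) \<le> K * prod_list (map norm xs))"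

lemma multilinear_form_update:
  "multilinear_form n K A \<Longrightarrow> length xs = n \<Longrightarrow> i < n \<Longrightarrow> clinear (\<lambda>x. A (xs[i := x]))"
  by (simp add: multilinear_form_def)

lemma multilinear_form_bound:
  "multilinear_form n K A \<Longrightarrow> length xs = n \<Longrightarrow> cmod (A xs) \<le> K * prod_list (map norm xs)"
  by (simp add: multilinear_form_def)

lemma multilinear_form_Cons_clinear:
  "multilinear_form (Suc n) K A \<Longrightarrow> length xs = n \<Longrightarrow> clinear (\<lambda>x. A (x # xs))"
  using multilinear_form_update[of "Suc n" K A "0 # xs" 0] by simp

lemma multilinear_form_Cons:
  assumes "multilinear_form (Suc n) K A"
  shows "multilinear_form n (K * norm x) (\<lambda>xs. A (x # xs))"
  unfolding multilinear_form_def
proof (intro conjI allI impI)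
  show "clinear (\<lambda>y. A (x # xs[i := y]))" if "length xs = n \<and> i < n" for xs i
    using multilinear_form_update[OF assms, of "x # xs" "Suc i"] that by simp
  show "cmod (A (x # xs)) \<le> K * norm x * prod_list (map norm xs)" if "length xs = n" for xs
    using multilinear_form_bound[OF assms, of "x # xs"] that by (simp add: mult_ac)
qed

lemma multilinear_form_map_scaleC:
  "multilinear_form n K A \<Longrightarrow> length xs = n \<Longrightarrow> A (map ((*\<^sub>C) c) xs) = c ^ n * A xs"
proof (induction n arbitrary: K A xs)
  case (Suc n)
  then obtain y ys where xs: "xs = y # ys" "length ys = n"
    by (auto simp: length_Suc_conv)
  have "A (map ((*\<^sub>C) c) xs) = c * A (y # map ((*\<^sub>C) c) ys)"
    using clinear_scaleC[OF multilinear_form_Cons_clinear[OF Suc.prems(1), of "map ((*\<^sub>C) c) ys"]] xs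
    by (simp add: scaleC_complex_def)
  then show ?case
    using Suc.IH[OF multilinear_form_Cons[OF Suc.prems(1)], of ys y] xs by simp
qed simp

lemma symmetric_form_multilinear:
  assumes "symmetric_form n A"
  obtains K where "multilinear_form n K A"
  using assms unfolding symmetric_form_def multilinear_form_def by blast

text \<open>Polarization by differentiation: the derivative moves \<open>h\<close> into one of the k
  diagonal slots, and symmetry makes the k contributions equal. For \<open>k = 0\<close> the
  truncated \<open>k - 1\<close> is harmless because the factor \<open>of_nat k\<close>
  vanishes.\<close>

lemma symmetric_form_polarization_derivative:
  assumes A: "symmetric_form n A"
  shows "k + length ys = n \<Longrightarrow> ((\<lambda>t. A (replicate k (x + t *\<^sub>C h) @ ys)) has_field_derivative
      of_nat k * A (replicate (k - 1) x @ h # ys)) (at 0)"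
proof (induction k arbitrary: ys)
  case (Suc k)
  obtain K where K: "multilinear_form n K A"
    using symmetric_form_multilinear[OF A] .
  have sym: "A xs = A ys" if "mset xs = mset ys" for xs ys
    using A that unfolding symmetric_form_def by blast
  have lin: "clinear (\<lambda>u. A (u # zs))" if "Suc (length zs) = n" for zs
    using K that multilinear_form_Cons_clinear by blast
  have "A (replicate (Suc k) (x + t *\<^sub>C h) @ ys)
      = A (replicate k (x + t *\<^sub>C h) @ x # ys) + t * A (replicate k (x + t *\<^sub>C h) @ h # ys)" for t
  proof -
    let ?zs = "replicate k (x + t *\<^sub>C h) @ ys"
    have "A (replicate (Suc k) (x + t *\<^sub>C h) @ ys) = A (x # ?zs) + t * A (h # ?zs)"
      using clinear_add[OF lin, of ?zs x "t *\<^sub>C h"] clinear_scaleC[OF lin, of ?zs t h] Suc.prems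
      by (simp add: scaleC_complex_def)
    moreover have "A (u # ?zs) = A (replicate k (x + t *\<^sub>C h) @ u # ys)" for u
      by (rule sym) simp
    ultimately show ?thesis
      by simp
  qed
  moreover have "((\<lambda>t. A (replicate k (x + t *\<^sub>C h) @ x # ys)
        + t * A (replicate k (x + t *\<^sub>C h) @ h # ys)) has_field_derivative
      of_nat (Suc k) * A (replicate k x @ h # ys)) (at 0)"
  proof -
    have eq: "of_nat k * A (replicate (k - 1) x @ h # x # ys) = of_nat k * A (replicate k x @ h # ys)"
      by (cases k) (auto intro!: sym)
    have len: "k + length (x # ys) = n" "k + length (h # ys) = n"
      using Suc.prems by auto
    show ?thesis
      by (rule DERIV_cong[OF DERIV_add[OF Suc.IH[OF len(1)]
            DERIV_mult[OF DERIV_ident Suc.IH[OF len(2)]]]])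
        (simp add: eq[simplified] distrib_right)
  qed
  ultimately show ?case
    by simp
qed simp

lemma symmetric_form_eqI:
  assumes A: "symmetric_form n A" and B: "symmetric_form n B"
    and eq: "\<And>x. A (replicate n x) = B (replicate n x)"
  shows "A = B"
proof
  \<comment> \<open>Induction on the number of slots already freed from the diagonal:
    differentiating the equality for \<open>ys\<close> frees one more. When all n slots are free
    this is the claim.\<close>
  have *: "A (replicate (n - length ys) x @ ys) = B (replicate (n - length ys) x @ ys)"
    if "length ys \<le> n" for x ys
    using that
  proof (induction ys arbitrary: x)
    case (Cons h ys)
    define k where "k = n - length ys"
    have k: "k + length ys = n" "k > 0" "k - 1 = n - length (h # ys)"
      using Cons.prems by (auto simp: k_def)
    have "(\<lambda>t. A (replicate k (x + t *\<^sub>C h) @ ys)) = (\<lambda>t. B (replicate k (x + t *\<^sub>C h) @ ys))"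
      using Cons by (simp add: k_def)
    then have "of_nat k * A (replicate (k - 1) x @ h # ys) = of_nat k * B (replicate (k - 1) x @ h # ys)"
      using DERIV_unique[OF symmetric_form_polarization_derivative[OF A k(1), of x h]]
        symmetric_form_polarization_derivative[OF B k(1), of x h] by simp
    then show ?case
      using k by simp
  qed (use eq in simp)
  fix xs
  show "A xs = B xs"
  proof (cases "length xs = n")
    case True
    then show ?thesis
      using *[of xs] by simp
  next
    case False
    then have "A xs = 0" "B xs = 0"
      using A B unfolding symmetric_form_def by blast+
    then show ?thesis
      by simp
  qed
qed

section \<open>Taylor series\<close>

definition taylor_form ::
    "nat \<Rightarrow> ('a::complex_normed_vector \<Rightarrow> complex) \<Rightarrow> 'a list \<Rightarrow> complex"
  where "taylor_form n f hs = (if length hs = n then foldr ddir hs f 0 / fact n else 0)"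

text \<open>The radius \<open>R\<close> is split into n equal steps, one for each derivative, which
  costs the factor n^n / n!. This is a single term of the exponential series at n, hence at most e^n
  \<le> 3^n. The case \<open>n = 0\<close> is separate because the step \<open>R / n\<close> needs a
  positive n.\<close>

lemma multilinear_form_taylor_form:
  assumes f: "entire f" and R: "R > 0" and M: "\<And>y. norm y \<le> R \<Longrightarrow> cmod (f y) \<le> M"
  shows "multilinear_form n (M * (3 / R) ^ n) (taylor_form n f)"
  unfolding multilinear_form_def
proof (intro conjI allI impI)
  fix hs :: "'a list" and i
  assume "length hs = n \<and> i < n"
  then show "clinear (\<lambda>h. taylor_form n f (hs[i := h]))"
    using clinear_foldr_ddir[OF f, of i hs 0]
    by (auto simp: taylor_form_def clinear_def scaleC_complex_def add_divide_distrib)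
next
  fix hs :: "'a list" assume n: "length hs = n"
  have M0: "M \<ge> 0"
    using M[of 0] R order_trans[OF norm_ge_zero] by simp
  show "cmod (taylor_form n f hs) \<le> M * (3 / R) ^ n * prod_list (map norm hs)"
  proof (cases "n = 0")
    case True
    then show ?thesis
      using M[of 0] R n by (simp add: taylor_form_def)
  next
    case False
    have "cmod (foldr ddir hs f 0) \<le> M * prod_list (map norm hs) / (R / n) ^ length hs"
      using False R n by (intro cmod_foldr_ddir_le[OF f] M) auto
    then have "cmod (taylor_form n f hs)
        \<le> M * prod_list (map norm hs) / R ^ n * (real n ^ n / fact n)"
      using n by (simp add: taylor_form_def norm_divide field_simps)
    also have "\<dots> \<le> M * prod_list (map norm hs) / R ^ n * 3 ^ n"
    proof (rule mult_left_mono)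
      have "real n ^ n / fact n \<le> (\<Sum>k\<in>{n}. real n ^ k / fact k)"
        by simp
      also have "\<dots> \<le> exp (real n)"
        using sum_le_suminf[OF summable_exp_generic[of "real n"], of "{n}"]
        by (simp add: exp_def scaleR_conv_of_real field_simps)
      also have "\<dots> = exp 1 ^ n"
        by (simp flip: exp_of_nat_mult)
      also have "\<dots> \<le> 3 ^ n"
        using exp_le by (intro power_mono) auto
      finally show "real n ^ n / fact n \<le> 3 ^ n" .
      show "0 \<le> M * prod_list (map norm hs) / R ^ n"
        using M0 R by (intro divide_nonneg_pos mult_nonneg_nonneg prod_list_nonneg) auto
    qed
    also have "\<dots> = M * (3 / R) ^ n * prod_list (map norm hs)"
      by (simp add: power_divide)
    finally show ?thesis .
  qed
qed

lemma symmetric_form_taylor_form: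
  assumes f: "entire f"
  shows "symmetric_form n (taylor_form n f)"
proof -
  obtain r where r: "r > 0" "\<And>y. norm (y - 0) \<le> r \<Longrightarrow> cmod (f y) \<le> cmod (f 0) + 1"
    using entire_locally_bounded[OF f] by blast
  then have "multilinear_form n ((cmod (f 0) + 1) * (3 / r) ^ n) (taylor_form n f)"
    by (intro multilinear_form_taylor_form[OF f]) auto
  moreover have "taylor_form n f xs = taylor_form n f ys" if "mset xs = mset ys" for xs ys
    using foldr_ddir_mset[OF f that] mset_eq_length[OF that] by (simp add: taylor_form_def)
  moreover have "taylor_form n f xs = 0" if "length xs \<noteq> n" for xs
    using that by (simp add: taylor_form_def)
  ultimately show ?thesis
    unfolding symmetric_form_def multilinear_form_def by blast
qed

text \<open>The power series of \<open>f\<close> on the complex line through \<open>x\<close>, taken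
  on the disc of radius 2 so that the parameter 1 lies inside.\<close>

lemma taylor_form_sums:
  assumes f: "entire f"
  shows "(\<lambda>n. taylor_form n f (replicate n x)) sums f x"
proof -
  have "(\<lambda>n. (deriv ^^ n) (\<lambda>s. f (0 + s *\<^sub>C x)) 0 / fact n * (1 - 0) ^ n) sums f (0 + 1 *\<^sub>C x)"
    by (rule holomorphic_power_series[where r = 2, OF entire_holomorphic_line[OF f]]) simp
  then show ?thesis
    using foldr_ddir_replicate[of _ x f 0] by (simp add: taylor_form_def)
qed

text \<open>The difference series sums to 0 on a disc, while a non-zero coefficient of positive
  index would make its zero at the centre isolated. Index 0 is settled by evaluation at 0.\<close>

lemma powser_coeffs_unique:
  fixes a b :: "nat \<Rightarrow> 'a::{real_normed_field,banach}"
  assumes r: "r > 0" and a: "\<And>x. norm x < r \<Longrightarrow> (\<lambda>n. a n * x ^ n) sums f x"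
    and b: "\<And>x. norm x < r \<Longrightarrow> (\<lambda>n. b n * x ^ n) sums f x"
  shows "a = b"
proof
  fix m
  have c: "(\<lambda>n. (a n - b n) * (x - 0) ^ n) sums 0" if "norm (x - 0) < r" for x
    using sums_diff[OF a[of x] b[of x]] that by (simp add: algebra_simps)
  show "a m = b m"
  proof (cases "m = 0")
    case True
    then show ?thesis
      using c[of 0] r by simp
  next
    case False
    show ?thesis
    proof (rule ccontr)
      assume "a m \<noteq> b m"
      then obtain s where s: "s > 0" "\<And>z::'a. z \<in> cball 0 s - {0} \<Longrightarrow> (0::'a) \<noteq> 0"
        using powser_0_nonzero[OF r c, of m] False by auto
      from s(2)[of "of_real s"] s(1) show False
        by simp
    qed
  qed
qed

lemma homogeneous_polynomial_scaleC:
  assumes "homogeneous_polynomial n P"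
  shows "P (c *\<^sub>C x) = c ^ n * P x"
proof -
  obtain A where A: "symmetric_form n A" "\<And>x. P x = A (replicate n x)"
    using assms unfolding homogeneous_polynomial_def by blast
  obtain K where "multilinear_form n K A"
    using symmetric_form_multilinear[OF A(1)] .
  from multilinear_form_map_scaleC[OF this, of "replicate n x" c] show ?thesis
    by (simp add: A(2))
qed

lemma taylor_polynomials_eq:
  fixes f :: "'a::complex_normed_vector \<Rightarrow> complex"
  assumes f: "entire f"
  shows "taylor_polynomials f = (\<lambda>n x. taylor_form n f (replicate n x))"
  unfolding taylor_polynomials_def
proof (rule the_equality)
  obtain r where r: "r > 0" "\<And>y. norm (y - 0) \<le> r \<Longrightarrow> cmod (f y) \<le> cmod (f 0) + 1"
    using entire_locally_bounded[OF f] by blast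
  define M where "M = cmod (f 0) + 1"
  have ml: "multilinear_form n (M * (3 / r) ^ n) (taylor_form n f)" for n
    using r by (intro multilinear_form_taylor_form[OF f]) (auto simp: M_def)
  \<comment> \<open>On this ball \<open>3 / r * norm x\<close> is at most 1/2, so the norm bounds of
    the forms give a geometric majorant.\<close>
  have "uniform_limit (ball 0 (r / 6)) (\<lambda>N x. \<Sum>n<N. taylor_form n f (replicate n x))
      (\<lambda>x. \<Sum>n. taylor_form n f (replicate n x)) sequentially"
  proof (rule Weierstrass_m_test)
    show "summable (\<lambda>n. M * (1 / 2) ^ n)"
      by (intro summable_mult summable_geometric) simp
    fix n and x :: 'a assume x: "x \<in> ball 0 (r / 6)"
    have "cmod (taylor_form n f (replicate n x)) \<le> M * (3 / r) ^ n * norm x ^ n"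
      using multilinear_form_bound[OF ml, of "replicate n x"] by simp
    also have "\<dots> = M * (3 / r * norm x) ^ n"
      unfolding power_mult_distrib by simp
    also have "\<dots> \<le> M * (1 / 2) ^ n"
      using x r by (intro mult_left_mono power_mono) (auto simp: M_def field_simps)
    finally show "cmod (taylor_form n f (replicate n x)) \<le> M * (1 / 2) ^ n" .
  qed
  also have "(\<lambda>x. \<Sum>n. taylor_form n f (replicate n x)) = f"
    using sums_unique[OF taylor_form_sums[OF f]] by auto
  finally have "\<exists>r>0. uniform_limit (ball 0 r) (\<lambda>N x. \<Sum>n<N. taylor_form n f (replicate n x)) f
      sequentially"
    using r(1) by (intro exI[of _ "r / 6"]) auto
  then show "(\<forall>n. homogeneous_polynomial n (\<lambda>x. taylor_form n f (replicate n x))) \<and>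
    (\<exists>r>0. uniform_limit (ball 0 r) (\<lambda>N x. \<Sum>n<N. taylor_form n f (replicate n x)) f sequentially)"
    using symmetric_form_taylor_form[OF f] unfolding homogeneous_polynomial_def by blast
next
  fix P
  assume "(\<forall>n. homogeneous_polynomial n (P n)) \<and>
    (\<exists>r>0. uniform_limit (ball 0 r) (\<lambda>N x. \<Sum>n<N. P n x) f sequentially)"
  then obtain r where hom: "\<And>n. homogeneous_polynomial n (P n)" and r: "r > 0"
    and lim: "uniform_limit (ball 0 r) (\<lambda>N x. \<Sum>n<N. P n x) f sequentially"
    by blast
  have hom': "homogeneous_polynomial n (\<lambda>x. taylor_form n f (replicate n x))" for n
    using symmetric_form_taylor_form[OF f] unfolding homogeneous_polynomial_def by blast
  \<comment> \<open>Uniqueness is a one-variable matter: by homogeneity both expansions are power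
    series in t on the line through \<open>x\<close>. The radius has \<open>norm x + 1\<close> in
    the denominator to allow \<open>x = 0\<close>.\<close>
  have "(\<lambda>n. P n x) = (\<lambda>n. taylor_form n f (replicate n x))" for x
  proof (rule powser_coeffs_unique)
    show "r / (norm x + 1) > 0"
      using r by (simp add: add_nonneg_pos)
    fix t :: complex assume t: "norm t < r / (norm x + 1)"
    have "norm (t *\<^sub>C x) \<le> norm t * (norm x + 1)"
      by (simp add: norm_scaleC algebra_simps)
    also have "\<dots> < r"
      using t add_nonneg_pos[of "norm x" 1] by (simp add: pos_less_divide_eq)
    finally have "(\<lambda>N. \<Sum>n<N. P n (t *\<^sub>C x)) \<longlonglongrightarrow> f (t *\<^sub>C x)"
      by (intro tendsto_uniform_limitI[OF lim]) simp
    then show "(\<lambda>n. P n x * t ^ n) sums f (t *\<^sub>C x)"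
      unfolding sums_def homogeneous_polynomial_scaleC[OF hom] by (simp add: mult.commute)
    show "(\<lambda>n. taylor_form n f (replicate n x) * t ^ n) sums f (t *\<^sub>C x)"
      using taylor_form_sums[OF f, of "t *\<^sub>C x"]
      unfolding homogeneous_polynomial_scaleC[OF hom'] by (simp add: mult.commute)
  qed
  then show "P = (\<lambda>n x. taylor_form n f (replicate n x))"
    by (auto simp: fun_eq_iff)
qed

lemma form_of_taylor_polynomials:
  assumes f: "entire f"
  shows "form_of_polynomial n (taylor_polynomials f n) = taylor_form n f"
  unfolding form_of_polynomial_def taylor_polynomials_eq[OF f]
  by (rule the_equality) (auto intro: symmetric_form_taylor_form[OF f] symmetric_form_eqI)

section \<open>The bidual and weak-star limits\<close>

lemma cdual_apply_clinear: "clinear (cdual_apply \<gamma>)"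
  using blinfun_of_cdual[of \<gamma>] by (simp add: cdual_apply_def)

lemma cdual_apply_bounded_linear: "bounded_linear (cdual_apply \<gamma>)"
  unfolding cdual_apply_def by (rule blinfun.bounded_linear_right)

lemma cmod_cdual_apply_le: "cmod (cdual_apply \<gamma> x) \<le> norm \<gamma> * norm x"
  unfolding cdual_apply_def norm_cdual.rep_eq by (rule norm_blinfun)

lemma cdual_eqI: "(\<And>x. cdual_apply \<gamma> x = cdual_apply \<delta> x) \<Longrightarrow> \<gamma> = \<delta>"
  by (simp add: cdual_apply_def blinfun_eqI flip: blinfun_of_cdual_inject)

lemma cdual_apply_add: "cdual_apply (\<gamma> + \<delta>) x = cdual_apply \<gamma> x + cdual_apply \<delta> x"
  by (simp add: cdual_apply_def plus_cdual.rep_eq plus_blinfun.rep_eq)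

lemma cdual_apply_diff: "cdual_apply (\<gamma> - \<delta>) x = cdual_apply \<gamma> x - cdual_apply \<delta> x"
  by (simp add: cdual_apply_def minus_cdual.rep_eq minus_blinfun.rep_eq)

lemma cdual_apply_scaleC: "cdual_apply (c *\<^sub>C \<gamma>) x = c * cdual_apply \<gamma> x"
  by (simp add: cdual_apply_def scaleC_cdual.rep_eq)

lemma cdual_of_clinear:
  assumes "clinear f" "\<And>x. cmod (f x) \<le> K * norm x" "K \<ge> 0"
  obtains \<gamma> where "cdual_apply \<gamma> = f" "norm \<gamma> \<le> K"
proof -
  have b: "blinfun_apply (Blinfun f) = f"
    by (rule bounded_linear_Blinfun_apply[OF clinear_bounded_linear[OF assms(1,2)]])
  then have eq: "blinfun_of_cdual (Abs_cdual (Blinfun f)) = Blinfun f"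
    using assms(1) by (intro Abs_cdual_inverse) simp
  have "norm (Abs_cdual (Blinfun f)) \<le> K"
    unfolding norm_cdual.rep_eq eq by (rule norm_blinfun_bound) (use b assms in auto)
  then show ?thesis
    using that[of "Abs_cdual (Blinfun f)"] by (simp add: cdual_apply_def eq b)
qed

lemma canonical_embedding_apply:
  fixes x :: "'a::complex_normed_vector"
  shows "cdual_apply (canonical_embedding x) \<gamma> = cdual_apply \<gamma> x"
    and "norm (canonical_embedding x) \<le> norm x"
proof -
  obtain z :: "'a cdual cdual" where z: "cdual_apply z = (\<lambda>\<gamma>. cdual_apply \<gamma> x)" "norm z \<le> norm x"
  proof (rule cdual_of_clinear)
    show "clinear (\<lambda>\<gamma>. cdual_apply \<gamma> x)"
      by (simp add: clinear_def cdual_apply_add cdual_apply_scaleC scaleC_complex_def)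
    show "cmod (cdual_apply \<gamma> x) \<le> norm x * norm \<gamma>" for \<gamma>
      using cmod_cdual_apply_le[of \<gamma> x] by (simp add: mult.commute)
  qed auto
  have "canonical_embedding x = z"
    unfolding canonical_embedding_def by (rule the_equality) (auto simp: z intro: cdual_eqI)
  with z show "cdual_apply (canonical_embedding x) \<gamma> = cdual_apply \<gamma> x"
    "norm (canonical_embedding x) \<le> norm x"
    by auto
qed

lemma canonical_embedding_linear:
  "clinear (canonical_embedding :: 'a::complex_normed_vector \<Rightarrow> _)"
  "bounded_linear (canonical_embedding :: 'a::complex_normed_vector \<Rightarrow> _)"
proof -
  show *: "clinear (canonical_embedding :: 'a::complex_normed_vector \<Rightarrow> _)"
    unfolding clinear_def
    by (auto simp: canonical_embedding_apply cdual_apply_add cdual_apply_scaleC scaleC_complex_def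
        clinear_add[OF cdual_apply_clinear] clinear_scaleC[OF cdual_apply_clinear]
        intro!: cdual_eqI)
  show "bounded_linear (canonical_embedding :: 'a::complex_normed_vector \<Rightarrow> _)"
    by (rule clinear_bounded_linear[OF *, of 1]) (simp add: canonical_embedding_apply)
qed

text \<open>A functional vanishing on the common kernel of finitely many others lies in their span.
  Phrasing this as transport of interpolation from \<Gamma> to \<delta> avoids handling linear
  combinations.\<close>

lemma bidual_apply_of_kernel:
  fixes z :: "'a::complex_normed_vector cdual cdual"
  assumes "finite \<Gamma>" "\<And>u. (\<And>\<gamma>. \<gamma> \<in> \<Gamma> \<Longrightarrow> cdual_apply \<gamma> u = 0) \<Longrightarrow> cdual_apply \<delta> u = 0"
    and "\<And>\<gamma>. \<gamma> \<in> \<Gamma> \<Longrightarrow> cdual_apply \<gamma> x = cdual_apply z \<gamma>"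
  shows "cdual_apply \<delta> x = cdual_apply z \<delta>"
  using assms
proof (induction \<Gamma> arbitrary: \<delta> rule: finite_induct)
  case empty
  have "\<delta> = 0 *\<^sub>C \<delta>"
    using empty by (intro cdual_eqI) (simp only: cdual_apply_scaleC, simp)
  then have "cdual_apply z \<delta> = 0"
    using clinear_zero[OF cdual_apply_clinear[of z]] by simp
  then show ?case
    using empty by simp
next
  case (insert \<beta> \<Gamma>)
  show ?case
  proof (cases "\<exists>u. (\<forall>\<gamma>\<in>\<Gamma>. cdual_apply \<gamma> u = 0) \<and> cdual_apply \<beta> u \<noteq> 0")
    case False
    then have "cdual_apply \<delta> u = 0" if "\<And>\<gamma>. \<gamma> \<in> \<Gamma> \<Longrightarrow> cdual_apply \<gamma> u = 0" for u
      using that insert.prems(1)[of u] by auto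
    then show ?thesis
      using insert.IH[of \<delta>] insert.prems by blast
  next
    case True
    then obtain u where u: "\<And>\<gamma>. \<gamma> \<in> \<Gamma> \<Longrightarrow> cdual_apply \<gamma> u = 0" "cdual_apply \<beta> u \<noteq> 0"
      by blast
    \<comment> \<open>With this \<open>c\<close> the functional
      \<open>\<delta> - c *\<^sub>C \<beta>\<close> kills \<open>u\<close>. It also vanishes on the
      common kernel of \<Gamma>: a vector \<open>w\<close> there becomes, after subtracting a
      multiple of \<open>u\<close>, a vector that \<beta> kills too.\<close>
    define c where "c = cdual_apply \<delta> u / cdual_apply \<beta> u"
    have "cdual_apply (\<delta> - c *\<^sub>C \<beta>) x = cdual_apply z (\<delta> - c *\<^sub>C \<beta>)"
    proof (rule insert.IH)
      fix w assume w: "\<And>\<gamma>. \<gamma> \<in> \<Gamma> \<Longrightarrow> cdual_apply \<gamma> w = 0"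
      define w' where "w' = w - (cdual_apply \<beta> w / cdual_apply \<beta> u) *\<^sub>C u"
      have eq: "cdual_apply \<gamma> w' = cdual_apply \<gamma> w - cdual_apply \<beta> w / cdual_apply \<beta> u * cdual_apply \<gamma> u"
        for \<gamma>
        by (simp add: w'_def clinear_diff[OF cdual_apply_clinear]
            clinear_scaleC[OF cdual_apply_clinear] scaleC_complex_def)
      have "cdual_apply \<delta> w' = 0"
        by (rule insert.prems(1)) (use w u in \<open>auto simp: eq\<close>)
      then show "cdual_apply (\<delta> - c *\<^sub>C \<beta>) w = 0"
        by (simp add: eq cdual_apply_diff cdual_apply_scaleC c_def mult.commute)
    qed (use insert.prems in auto)
    then show ?thesis
      using insert.prems(2)[of \<beta>]
      by (simp add: clinear_diff[OF cdual_apply_clinear[of z]]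
          clinear_scaleC[OF cdual_apply_clinear[of z]] scaleC_complex_def
          cdual_apply_diff cdual_apply_scaleC)
  qed
qed

text \<open>Helly's theorem without control of the norm, which is enough because the weak-star
  filter imposes no bound. A vector of the common kernel of \<Gamma> on which \<delta> does not
  vanish corrects the value at \<delta>; if there is none, that value is already right.\<close>

lemma bidual_interpolation:
  fixes z :: "'a::complex_normed_vector cdual cdual"
  assumes "finite \<Gamma>"
  shows "\<exists>x. \<forall>\<gamma>\<in>\<Gamma>. cdual_apply \<gamma> x = cdual_apply z \<gamma>"
  using assms
proof (induction \<Gamma> rule: finite_induct)
  case (insert \<delta> \<Gamma>)
  then obtain x where x: "\<And>\<gamma>. \<gamma> \<in> \<Gamma> \<Longrightarrow> cdual_apply \<gamma> x = cdual_apply z \<gamma>"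
    by blast
  show ?case
  proof (cases "\<exists>u. (\<forall>\<gamma>\<in>\<Gamma>. cdual_apply \<gamma> u = 0) \<and> cdual_apply \<delta> u \<noteq> 0")
    case False
    then have "cdual_apply \<delta> x = cdual_apply z \<delta>"
      using bidual_apply_of_kernel[OF insert.hyps(1) _ x] by blast
    then show ?thesis
      using x by blast
  next
    case True
    then obtain u where u: "\<And>\<gamma>. \<gamma> \<in> \<Gamma> \<Longrightarrow> cdual_apply \<gamma> u = 0" "cdual_apply \<delta> u \<noteq> 0"
      by blast
    define c where "c = (cdual_apply z \<delta> - cdual_apply \<delta> x) / cdual_apply \<delta> u"
    have "cdual_apply \<gamma> (x + c *\<^sub>C u) = cdual_apply z \<gamma>" if "\<gamma> \<in> insert \<delta> \<Gamma>" for \<gamma>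
      using that x u
      by (auto simp: clinear_add[OF cdual_apply_clinear] clinear_scaleC[OF cdual_apply_clinear]
          scaleC_complex_def c_def)
    then show ?thesis
      by blast
  qed
qed simp

text \<open>An event in an infimum of filters depends on finitely many of them, and the exact
  interpolation point lies in every member of these. Properness is what makes limits along the
  filter unique, hence \<open>Lim\<close> meaningful.\<close>

lemma weak_star_filter_nontrivial: "weak_star_filter z \<noteq> bot"
proof
  assume "weak_star_filter z = bot"
  then have "eventually (\<lambda>_. False) (INF \<gamma>. filtercomap (cdual_apply \<gamma>) (nhds (cdual_apply z \<gamma>)))"
    by (simp add: weak_star_filter_def)
  then obtain \<Gamma> where \<Gamma>: "finite \<Gamma>"
    "eventually (\<lambda>_. False) (INF \<gamma>\<in>\<Gamma>. filtercomap (cdual_apply \<gamma>) (nhds (cdual_apply z \<gamma>)))"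
    using iffD1[OF eventually_INF] by blast
  obtain x where x: "\<And>\<gamma>. \<gamma> \<in> \<Gamma> \<Longrightarrow> cdual_apply \<gamma> x = cdual_apply z \<gamma>"
    using bidual_interpolation[OF \<Gamma>(1), of z] by blast
  have "principal {x} \<le> (INF \<gamma>\<in>\<Gamma>. filtercomap (cdual_apply \<gamma>) (nhds (cdual_apply z \<gamma>)))"
  proof (rule INF_greatest)
    fix \<gamma> assume "\<gamma> \<in> \<Gamma>"
    then show "principal {x} \<le> filtercomap (cdual_apply \<gamma>) (nhds (cdual_apply z \<gamma>))"
      using x[of \<gamma>]
        tendsto_principal_singleton[of "cdual_apply \<gamma>" x]
      by (simp add: filterlim_iff_le_filtercomap)
  qed
  then have "eventually (\<lambda>_. False) (principal {x})"
    using \<Gamma>(2) unfolding le_filter_def by blast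
  then show False
    by (simp add: eventually_principal)
qed

lemma Lim_weak_star_filter: "Lim (weak_star_filter z) (cdual_apply \<gamma>) = cdual_apply z \<gamma>"
proof (rule tendsto_Lim[OF weak_star_filter_nontrivial])
  show "(cdual_apply \<gamma> \<longlongrightarrow> cdual_apply z \<gamma>) (weak_star_filter z)"
    unfolding filterlim_iff_le_filtercomap weak_star_filter_def
    by (rule INF_lower) simp
qed

section \<open>Extension of multilinear forms to the bidual\<close>

lemma extend_form_cong:
  "(\<And>xs. length xs = length zs \<Longrightarrow> A xs = B xs) \<Longrightarrow> extend_form A zs = extend_form B zs"
proof (induction zs arbitrary: A B)
  case (Cons z zs)
  have "extend_form (\<lambda>xs. A (x # xs)) zs = extend_form (\<lambda>xs. B (x # xs)) zs" for x
    by (rule Cons.IH) (use Cons.prems in auto)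
  then show ?case
    by simp
qed simp

lemma extend_form_zero: "extend_form (\<lambda>_. 0) zs = 0"
  by (induction zs) (auto intro: tendsto_Lim[OF weak_star_filter_nontrivial])

text \<open>Each of the iterated limits is the limit of a bounded linear functional, hence exists
  along the weak-star filter although this filter contains unbounded nets.\<close>

lemma extend_form_functional:
  fixes zs :: "'a::complex_normed_vector cdual cdual list"
  assumes bound: "\<And>A K. multilinear_form (length zs) K A \<Longrightarrow> K \<ge> 0 \<Longrightarrow>
      cmod (extend_form A zs) \<le> K * prod_list (map norm zs)"
    and linear: "\<And>A B K L c. multilinear_form (length zs) K A \<Longrightarrow>
      multilinear_form (length zs) L B \<Longrightarrow> K \<ge> 0 \<Longrightarrow> L \<ge> 0 \<Longrightarrow>
      extend_form (\<lambda>xs. A xs + c * B xs) zs = extend_form A zs + c * extend_form B zs"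
    and A: "multilinear_form (Suc (length zs)) K A" and K: "K \<ge> 0"
  shows "\<exists>\<gamma>. cdual_apply \<gamma> = (\<lambda>x. extend_form (\<lambda>xs. A (x # xs)) zs) \<and>
    norm \<gamma> \<le> K * prod_list (map norm zs) \<and> (\<forall>z. extend_form A (z # zs) = cdual_apply z \<gamma>)"
proof -
  note A' = multilinear_form_Cons[OF A]
  note lin = multilinear_form_Cons_clinear[OF A]
  have *: "extend_form (\<lambda>xs. A ((x + c *\<^sub>C y) # xs)) zs
      = extend_form (\<lambda>xs. A (x # xs)) zs + c * extend_form (\<lambda>xs. A (y # xs)) zs" for x y c
  proof -
    have "extend_form (\<lambda>xs. A ((x + c *\<^sub>C y) # xs)) zs
        = extend_form (\<lambda>xs. A (x # xs) + c * A (y # xs)) zs"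
      by (rule extend_form_cong)
        (simp add: clinear_add[OF lin] clinear_scaleC[OF lin] scaleC_complex_def)
    also have "\<dots> = extend_form (\<lambda>xs. A (x # xs)) zs + c * extend_form (\<lambda>xs. A (y # xs)) zs"
      by (rule linear[OF A' A']) (use K in auto)
    finally show ?thesis .
  qed
  have "clinear (\<lambda>x. extend_form (\<lambda>xs. A (x # xs)) zs)"
    unfolding clinear_def
  proof (intro conjI allI)
    show "extend_form (\<lambda>xs. A ((x + y) # xs)) zs
        = extend_form (\<lambda>xs. A (x # xs)) zs + extend_form (\<lambda>xs. A (y # xs)) zs" for x y
      using *[of x 1 y] by simp
    have "extend_form (\<lambda>xs. A (0 # xs)) zs = 0"
      using *[of 0 1 0] by simp
    then show "extend_form (\<lambda>xs. A ((c *\<^sub>C y) # xs)) zs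
        = c *\<^sub>C extend_form (\<lambda>xs. A (y # xs)) zs" for c y
      using *[of 0 c y] by (simp add: scaleC_complex_def)
  qed
  moreover have "cmod (extend_form (\<lambda>xs. A (x # xs)) zs) \<le> K * prod_list (map norm zs) * norm x" for x
    using bound[OF A'[of x]] K by (simp add: mult_ac)
  moreover have "K * prod_list (map norm zs) \<ge> 0"
    using K by (intro mult_nonneg_nonneg prod_list_nonneg) auto
  ultimately obtain \<gamma> where "cdual_apply \<gamma> = (\<lambda>x. extend_form (\<lambda>xs. A (x # xs)) zs)"
    "norm \<gamma> \<le> K * prod_list (map norm zs)"
    by (rule cdual_of_clinear)
  then show ?thesis
    using Lim_weak_star_filter[of _ \<gamma>] by (intro exI[of _ \<gamma>]) simp
qed

text \<open>Proved simultaneously because neither half is inductive alone: only bound and linearity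
  together show that the inner extension is a bounded functional of the head variable, and hence
  that the outer limit is evaluation of \<open>z\<close> at it.\<close>

lemma extend_form_bound_linear:
  fixes zs :: "'a::complex_normed_vector cdual cdual list"
  shows extend_form_bound: "multilinear_form (length zs) K A \<Longrightarrow> K \<ge> 0 \<Longrightarrow>
      cmod (extend_form A zs) \<le> K * prod_list (map norm zs)"
    and "multilinear_form (length zs) K A \<Longrightarrow>
      multilinear_form (length zs) L B \<Longrightarrow> K \<ge> 0 \<Longrightarrow> L \<ge> 0 \<Longrightarrow>
      extend_form (\<lambda>xs. A xs + c * B xs) zs = extend_form A zs + c * extend_form B zs"
proof (induction zs arbitrary: K A L B c)
  case Nil
  {
    case 1
    then show ?case
      using multilinear_form_bound[of 0 K A "[]"] by simp
  next
    case 2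
    then show ?case
      by simp
  }
next
  case (Cons z zs)
  have functional: "\<exists>\<gamma>. cdual_apply \<gamma> = (\<lambda>x. extend_form (\<lambda>xs. A (x # xs)) zs) \<and>
      norm \<gamma> \<le> K * prod_list (map norm zs) \<and> (\<forall>z. extend_form A (z # zs) = cdual_apply z \<gamma>)"
    if "multilinear_form (Suc (length zs)) K A" "K \<ge> 0" for A K
    by (rule extend_form_functional[OF _ _ that]; rule Cons.IH; assumption)
  {
    case 1
    then have A: "multilinear_form (Suc (length zs)) K A" and K: "K \<ge> 0"
      by auto
    obtain \<gamma> where \<gamma>: "norm \<gamma> \<le> K * prod_list (map norm zs)"
      "extend_form A (z # zs) = cdual_apply z \<gamma>"
      using functional[OF A K] by blast
    have "cmod (extend_form A (z # zs)) \<le> norm z * norm \<gamma>"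
      unfolding \<gamma>(2) by (rule cmod_cdual_apply_le)
    also have "\<dots> \<le> norm z * (K * prod_list (map norm zs))"
      using \<gamma>(1) by (intro mult_left_mono) auto
    finally show ?case
      by (simp add: mult_ac)
  next
    case 2
    then have A: "multilinear_form (Suc (length zs)) K A" and B: "multilinear_form (Suc (length zs)) L B"
      and KL: "K \<ge> 0" "L \<ge> 0"
      by auto
    obtain \<gamma> where \<gamma>: "cdual_apply \<gamma> = (\<lambda>x. extend_form (\<lambda>xs. A (x # xs)) zs)"
      "extend_form A (z # zs) = cdual_apply z \<gamma>"
      using functional[OF A KL(1)] by blast
    obtain \<delta> where \<delta>: "cdual_apply \<delta> = (\<lambda>x. extend_form (\<lambda>xs. B (x # xs)) zs)"
      "extend_form B (z # zs) = cdual_apply z \<delta>"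
      using functional[OF B KL(2)] by blast
    have "extend_form (\<lambda>xs. A (x # xs) + c * B (x # xs)) zs
        = extend_form (\<lambda>xs. A (x # xs)) zs + c * extend_form (\<lambda>xs. B (x # xs)) zs" for x
      by (rule Cons.IH(2)[OF multilinear_form_Cons[OF A] multilinear_form_Cons[OF B]])
        (use KL in auto)
    then have "(\<lambda>x. extend_form (\<lambda>xs. A (x # xs) + c * B (x # xs)) zs) = cdual_apply (\<gamma> + c *\<^sub>C \<delta>)"
      by (auto simp: cdual_apply_add cdual_apply_scaleC \<gamma>(1) \<delta>(1))
    then have "extend_form (\<lambda>xs. A xs + c * B xs) (z # zs) = cdual_apply z (\<gamma> + c *\<^sub>C \<delta>)"
      by (simp add: Lim_weak_star_filter)
    then show ?case
      unfolding \<gamma>(2) \<delta>(2)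
      by (simp only: clinear_add[OF cdual_apply_clinear] clinear_scaleC[OF cdual_apply_clinear]
          scaleC_complex_def)
  }
qed

lemma extend_form_Cons:
  assumes "multilinear_form (Suc (length zs)) K A" "K \<ge> 0"
  shows "\<exists>\<gamma>. cdual_apply \<gamma> = (\<lambda>x. extend_form (\<lambda>xs. A (x # xs)) zs) \<and>
    (\<forall>z. extend_form A (z # zs) = cdual_apply z \<gamma>)"
proof -
  have "\<exists>\<gamma>. cdual_apply \<gamma> = (\<lambda>x. extend_form (\<lambda>xs. A (x # xs)) zs) \<and>
      norm \<gamma> \<le> K * prod_list (map norm zs) \<and> (\<forall>z. extend_form A (z # zs) = cdual_apply z \<gamma>)"
    by (rule extend_form_functional[OF _ _ assms]; rule extend_form_bound_linear; assumption)
  then show ?thesis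
    by blast
qed

text \<open>In the head slot the extension is evaluation at a fixed functional, which is linear in
  the bidual variable. In a later slot the representing functional \<open>\<gamma> u\<close> depends
  linearly on \<open>u\<close> by the induction hypothesis for the slices, and evaluation at
  \<open>z\<close> preserves this.\<close>

lemma multilinear_form_extend_form:
  assumes "multilinear_form n K A" "K \<ge> 0"
  shows "multilinear_form n K (extend_form A)"
proof -
  have "clinear (\<lambda>u. extend_form A (zs[i := u]))"
    if "multilinear_form (length zs) K A" "K \<ge> 0" "i < length zs" for A K zs i
    using that
  proof (induction zs arbitrary: A K i)
    case (Cons z zs)
    show ?case
    proof (cases i)
      case 0
      obtain \<gamma> where "\<And>z. extend_form A (z # zs) = cdual_apply z \<gamma>"
        using extend_form_Cons[of zs K A] Cons.prems by auto
      then show ?thesis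
        by (simp add: 0 clinear_def cdual_apply_add cdual_apply_scaleC scaleC_complex_def
            del: extend_form.simps)
    next
      case (Suc j)
      have "\<exists>\<gamma>. cdual_apply \<gamma> = (\<lambda>x. extend_form (\<lambda>xs. A (x # xs)) (zs[j := u])) \<and>
          (\<forall>z. extend_form A (z # zs[j := u]) = cdual_apply z \<gamma>)" for u
        using extend_form_Cons[of "zs[j := u]" K A] Cons.prems by simp
      then obtain \<gamma> where \<gamma>: "\<And>u. cdual_apply (\<gamma> u) = (\<lambda>x. extend_form (\<lambda>xs. A (x # xs)) (zs[j := u]))"
        "\<And>u z. extend_form A (z # zs[j := u]) = cdual_apply z (\<gamma> u)"
        by metis
      have lin: "clinear (\<lambda>u. extend_form (\<lambda>xs. A (x # xs)) (zs[j := u]))" for x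
        by (rule Cons.IH[OF multilinear_form_Cons]) (use Cons.prems Suc in auto)
      have "\<gamma> (u + w) = \<gamma> u + \<gamma> w" "\<gamma> (c *\<^sub>C u) = c *\<^sub>C \<gamma> u" for u w c
        by (auto intro!: cdual_eqI simp: \<gamma>(1) cdual_apply_add cdual_apply_scaleC
            clinear_add[OF lin] clinear_scaleC[OF lin] scaleC_complex_def)
      then show ?thesis
        by (simp add: Suc \<gamma>(2) clinear_def clinear_add[OF cdual_apply_clinear]
            clinear_scaleC[OF cdual_apply_clinear] del: extend_form.simps)
    qed
  qed simp
  then show ?thesis
    using assms extend_form_bound[of _ K A] unfolding multilinear_form_def[of n K "extend_form A"]
    by auto
qed

section \<open>The Aron--Berner extension is entire\<close>

text \<open>Induction on n by expanding the head slot. The first-order estimate is carried along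
  because it controls the cross term, where \<open>h\<close> already sits in the head slot.
  \<open>C\<close> must not depend on the form, since the hypothesis is applied to the slices at
  \<open>z\<close> and at \<open>h\<close>, with constants \<open>K * norm z\<close> and
  \<open>K * norm h\<close>.\<close>

lemma multilinear_form_diagonal_remainder:
  fixes z :: "'a::complex_normed_vector"
  shows "\<exists>C\<ge>0. \<forall>A K h. multilinear_form n K A \<and> K \<ge> 0 \<and> norm h \<le> 1 \<longrightarrow>
    cmod (A (replicate n (z + h)) - A (replicate n z)) \<le> K * C * norm h \<and>
    cmod (A (replicate n (z + h)) - A (replicate n z) - (\<Sum>i<n. A ((replicate n z)[i := h])))
      \<le> K * C * (norm h)\<^sup>2"
proof (induction n)
  case 0
  show ?case
    by (intro exI[of _ 0]) auto
next
  case (Suc n)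
  then obtain C where C: "C \<ge> 0"
    and IH1: "\<And>A K h. multilinear_form n K A \<Longrightarrow> K \<ge> 0 \<Longrightarrow> norm h \<le> 1 \<Longrightarrow>
      cmod (A (replicate n (z + h)) - A (replicate n z)) \<le> K * C * norm h"
    and IH2: "\<And>A K h. multilinear_form n K A \<Longrightarrow> K \<ge> 0 \<Longrightarrow> norm h \<le> 1 \<Longrightarrow>
      cmod (A (replicate n (z + h)) - A (replicate n z) - (\<Sum>i<n. A ((replicate n z)[i := h])))
        \<le> K * C * (norm h)\<^sup>2"
    by blast
  \<comment> \<open>The summands come from the slice at \<open>z\<close>, from the first-order
    estimate of the slice at \<open>h\<close>, and from the crude bound of that slice on the
    diagonal at \<open>z + h\<close>.\<close>
  define C' where "C' = C * norm z + C + (norm z + 1) ^ n"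
  have C': "C' \<ge> 0"
    using C by (simp add: C'_def)
  show ?case
  proof (intro exI[of _ C'] conjI allI impI C'; elim conjE)
    fix A :: "'a list \<Rightarrow> complex" and K and h :: 'a
    assume A: "multilinear_form (Suc n) K A" and K: "K \<ge> 0" and h: "norm h \<le> 1"
    define r r' where "r = replicate n z" and "r' = replicate n (z + h)"
    note A' = multilinear_form_Cons[OF A]
    have split: "A ((z + h) # r') = A (z # r') + A (h # r')"
      using clinear_add[OF multilinear_form_Cons_clinear[OF A, of r']] by (simp add: r'_def)
    have z1: "cmod (A (z # r') - A (z # r)) \<le> K * norm z * C * norm h"
      using IH1[OF A' _ h, of z] K by (simp add: r_def r'_def)
    have z2: "cmod (A (z # r') - A (z # r) - (\<Sum>i<n. A (z # r[i := h]))) \<le> K * norm z * C * (norm h)\<^sup>2"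
      using IH2[OF A' _ h, of z] K by (simp add: r_def r'_def)
    have h1: "cmod (A (h # r') - A (h # r)) \<le> K * norm h * C * norm h"
      using IH1[OF A' _ h, of h] K by (simp add: r_def r'_def)
    have h0: "cmod (A (h # r')) \<le> K * norm h * (norm z + 1) ^ n"
    proof -
      have "cmod (A (h # r')) \<le> K * norm h * norm (z + h) ^ n"
        using multilinear_form_bound[OF A, of "h # r'"] by (simp add: r'_def mult.assoc)
      also have "\<dots> \<le> K * norm h * (norm z + 1) ^ n"
        using K h norm_triangle_ineq[of z h] by (intro mult_left_mono power_mono) auto
      finally show ?thesis .
    qed
    have "cmod (A ((z + h) # r') - A (z # r)) \<le> cmod (A (z # r') - A (z # r)) + cmod (A (h # r'))"
      unfolding split by (metis add_diff_eq add.commute norm_triangle_ineq)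
    also have "\<dots> \<le> K * (C * norm z + (norm z + 1) ^ n) * norm h"
      using add_mono[OF z1 h0] by (simp add: algebra_simps)
    also have "\<dots> \<le> K * C' * norm h"
      using C K by (intro mult_right_mono mult_left_mono) (auto simp: C'_def)
    finally show "cmod (A (replicate (Suc n) (z + h)) - A (replicate (Suc n) z)) \<le> K * C' * norm h"
      by (simp add: r_def r'_def)
    have sum: "(\<Sum>i<Suc n. A ((replicate (Suc n) z)[i := h])) = A (h # r) + (\<Sum>i<n. A (z # r[i := h]))"
      by (simp add: sum.lessThan_Suc_shift r_def del: sum.lessThan_Suc)
    have "cmod (A ((z + h) # r') - A (z # r) - (A (h # r) + (\<Sum>i<n. A (z # r[i := h]))))
        = cmod ((A (z # r') - A (z # r) - (\<Sum>i<n. A (z # r[i := h]))) + (A (h # r') - A (h # r)))"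
      unfolding split by (simp add: algebra_simps)
    also have "\<dots> \<le> K * norm z * C * (norm h)\<^sup>2 + K * norm h * C * norm h"
      by (rule norm_triangle_le[OF add_mono[OF z2 h1]])
    also have "\<dots> = K * (C * norm z + C) * (norm h)\<^sup>2"
      by (simp add: algebra_simps power2_eq_square)
    also have "\<dots> \<le> K * C' * (norm h)\<^sup>2"
      using K by (intro mult_right_mono mult_left_mono) (auto simp: C'_def)
    finally show "cmod (A (replicate (Suc n) (z + h)) - A (replicate (Suc n) z)
        - (\<Sum>i<Suc n. A ((replicate (Suc n) z)[i := h]))) \<le> K * C' * (norm h)\<^sup>2"
      unfolding sum by (simp add: r_def r'_def)
  qed
qed

lemma entire_multilinear_form_diagonal:
  fixes A :: "'a::complex_normed_vector list \<Rightarrow> complex"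
  assumes A: "multilinear_form n K A" and K: "K \<ge> 0"
  shows "entire (\<lambda>z. A (replicate n z))"
  unfolding entire_def
proof
  fix z :: 'a
  define D where "D h = (\<Sum>i<n. A ((replicate n z)[i := h]))" for h
  have lin: "clinear (\<lambda>h. A ((replicate n z)[i := h]))" if "i < n" for i
    using multilinear_form_update[OF A _ that] by simp
  have D: "clinear D"
    unfolding clinear_def D_def
    by (auto simp: clinear_add[OF lin] clinear_scaleC[OF lin] sum.distrib sum_distrib_left
        scaleC_complex_def)
  \<comment> \<open>Slot i holds \<open>h\<close>; the i slots before it and the
    \<open>n - Suc i\<close> slots after it hold \<open>z\<close>.\<close>
  define L where "L = (\<Sum>i<n. K * (norm z ^ i * norm z ^ (n - Suc i)))"
  have "cmod (D h) \<le> L * norm h" for h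
  proof -
    have "cmod (D h) \<le> (\<Sum>i<n. K * (norm z ^ i * norm z ^ (n - Suc i)) * norm h)"
      unfolding D_def
    proof (rule sum_norm_le)
      fix i assume i: "i \<in> {..<n}"
      then have "(replicate n z)[i := h] = replicate i z @ h # replicate (n - Suc i) z"
        by (simp add: upd_conv_take_nth_drop min_def)
      then show "cmod (A ((replicate n z)[i := h]))
          \<le> K * (norm z ^ i * norm z ^ (n - Suc i)) * norm h"
        using multilinear_form_bound[OF A, of "(replicate n z)[i := h]"] i by (simp add: mult_ac)
    qed
    then show ?thesis
      by (simp add: L_def sum_distrib_right)
  qed
  from clinear_bounded_linear[OF D this] have bl: "bounded_linear D" .
  obtain C where C: "\<And>h. norm h \<le> 1 \<Longrightarrow>
      cmod (A (replicate n (z + h)) - A (replicate n z) - D h) \<le> K * C * (norm h)\<^sup>2"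
    using multilinear_form_diagonal_remainder[of n z] A K unfolding D_def by blast
  have "((\<lambda>z. A (replicate n z)) has_derivative D) (at z)"
    by (rule has_derivative_quadratic[OF bl zero_less_one C])
  with D show "\<exists>D. ((\<lambda>z. A (replicate n z)) has_derivative D) (at z) \<and> clinear D"
    by blast
qed

lemma aron_berner_eq:
  "entire f \<Longrightarrow> aron_berner f z = (\<Sum>n. extend_form (taylor_form n f) (replicate n z))"
  by (simp add: aron_berner_def form_of_taylor_polynomials)

text \<open>With \<open>R = 6 * s\<close> the n-th form has bound
  \<open>M * (1 / (2 * s)) ^ n\<close>, and extension keeps it; on the ball of radius
  \<open>s\<close> the terms then decay like powers of 1/2.\<close>

lemma aron_berner_term_bound:
  fixes f :: "'a::complex_normed_vector \<Rightarrow> complex"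
  assumes f: "entire f" and s: "s > 0" and M: "\<And>y. norm y \<le> 6 * s \<Longrightarrow> cmod (f y) \<le> M"
    and z: "norm z \<le> s"
  shows "cmod (extend_form (taylor_form n f) (replicate n z)) \<le> M * (1 / 2) ^ n"
proof -
  have M0: "M \<ge> 0"
    using M[of 0] s order_trans[OF norm_ge_zero] by simp
  have "multilinear_form n (M * (3 / (6 * s)) ^ n) (taylor_form n f)"
    by (rule multilinear_form_taylor_form[OF f _ M]) (use s in auto)
  then have "cmod (extend_form (taylor_form n f) (replicate n z))
      \<le> M * (3 / (6 * s)) ^ n * prod_list (map norm (replicate n z))"
    using s M0 by (intro extend_form_bound) auto
  also have "\<dots> = M * (norm z / (2 * s)) ^ n"
    by (simp add: power_divide power_mult_distrib)
  also have "\<dots> \<le> M * (1 / 2) ^ n"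
    using z s M0 by (intro mult_left_mono power_mono) (auto simp: field_simps)
  finally show ?thesis .
qed

lemma aron_berner_bound:
  fixes f :: "'a::complex_normed_vector \<Rightarrow> complex"
  assumes f: "entire f" and s: "s > 0" and M: "\<And>y. norm y \<le> 6 * s \<Longrightarrow> cmod (f y) \<le> M"
    and z: "norm z \<le> s"
  shows "cmod (aron_berner f z) \<le> 2 * M"
proof -
  have "(\<lambda>n. M * (1 / 2) ^ n) sums (M * 2)"
    using geometric_sums[of "1 / 2 :: real"] by (intro sums_mult) simp
  from norm_suminf_le[OF aron_berner_term_bound[OF f s M z] sums_summable[OF this]]
    sums_unique[OF this]
  show ?thesis
    by (simp add: aron_berner_eq[OF f] mult.commute)
qed

text \<open>The partial sums are entire as finite sums of diagonals of extended forms, and they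
  converge uniformly near every point. Boundedness of \<open>f\<close> on balls is a genuine
  condition in infinite dimension and supplies the majorant.\<close>

lemma entire_aron_berner:
  fixes f :: "'a::complex_normed_vector \<Rightarrow> complex"
  assumes f: "entire f" and bounded: "\<And>r. \<exists>M. \<forall>y. norm y \<le> r \<longrightarrow> cmod (f y) \<le> M"
  shows "entire (aron_berner f)"
proof -
  define F where "F N z = (\<Sum>n<N. extend_form (taylor_form n f) (replicate n z))" for N z
  have "entire (F N)" for N
    unfolding F_def
  proof (rule entire_sum)
    fix n
    obtain M where M: "\<And>y. norm y \<le> 1 \<Longrightarrow> cmod (f y) \<le> M"
      using bounded[of 1] by blast
    then have "multilinear_form n (M * (3 / 1) ^ n) (taylor_form n f)"
      by (intro multilinear_form_taylor_form[OF f]) auto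
    moreover have "M \<ge> 0"
      using M[of 0] order_trans[OF norm_ge_zero] by simp
    ultimately show "entire (\<lambda>z. extend_form (taylor_form n f) (replicate n z))"
      by (intro entire_multilinear_form_diagonal[of n "M * (3 / 1) ^ n"]
          multilinear_form_extend_form) auto
  qed
  moreover have "\<exists>r>0. uniform_limit (cball x r) F (aron_berner f) sequentially" for x
  proof (intro exI conjI)
    have s: "norm x + 1 > 0"
      by (simp add: add_nonneg_pos)
    obtain M where M: "\<And>y. norm y \<le> 6 * (norm x + 1) \<Longrightarrow> cmod (f y) \<le> M"
      using bounded by blast
    have "uniform_limit (cball x 1) F
        (\<lambda>z. \<Sum>n. extend_form (taylor_form n f) (replicate n z)) sequentially"
      unfolding F_def
    proof (rule Weierstrass_m_test)
      show "summable (\<lambda>n. M * (1 / 2) ^ n)"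
        by (intro summable_mult summable_geometric) simp
      fix n z assume "z \<in> cball x 1"
      then have z: "norm z \<le> norm x + 1"
        using norm_triangle_sub[of z x] by (simp add: dist_norm norm_minus_commute)
      show "cmod (extend_form (taylor_form n f) (replicate n z)) \<le> M * (1 / 2) ^ n"
        by (rule aron_berner_term_bound[OF f s _ z]) (rule M)
    qed
    then show "uniform_limit (cball x 1) F (aron_berner f) sequentially"
      by (simp add: aron_berner_eq[OF f, abs_def])
  qed simp
  ultimately show ?thesis
    by (rule entire_uniform_limit(1))
qed

section \<open>The extension of a linear functional\<close>

lemma entire_cdual_apply: "entire (cdual_apply \<gamma>)"
  and ddir_cdual_apply: "ddir h (cdual_apply \<gamma>) = (\<lambda>_. cdual_apply \<gamma> h)"
proof -
  have *: "(cdual_apply \<gamma> has_derivative cdual_apply \<gamma>) (at x)" for x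
    by (rule bounded_linear_imp_has_derivative[OF cdual_apply_bounded_linear])
  then show ent: "entire (cdual_apply \<gamma>)"
    unfolding entire_def using cdual_apply_clinear by blast
  show "ddir h (cdual_apply \<gamma>) = (\<lambda>_. cdual_apply \<gamma> h)"
    using has_derivative_unique[OF has_derivative_ddir(1)[OF ent] *] by (metis)
qed

text \<open>Needed to compute the projection of a translated character. The first derivative of a
  functional is constant, so only the form of degree 1 survives, and its extension is a single
  weak-star limit.\<close>

lemma aron_berner_cdual:
  fixes \<gamma> :: "'a::complex_normed_vector cdual"
  shows "aron_berner (cdual_apply \<gamma>) z = cdual_apply z \<gamma>"
proof -
  have dzero: "foldr ddir hs (\<lambda>_. c) x = 0" if "hs \<noteq> []" for hs :: "'a list" and c x
    using that
  proof (induction hs arbitrary: x)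
    case (Cons h hs)
    then show ?case
      by (cases "hs = []") (auto simp: ddir_def[of h])
  qed simp
  have form: "taylor_form n (cdual_apply \<gamma>) hs = (case hs of [h] \<Rightarrow> if n = 1 then cdual_apply \<gamma> h else 0 | _ \<Rightarrow> 0)"
    for n hs
  \<comment> \<open>\<open>foldr\<close> differentiates along the last entry first, so the list is
    split at its end.\<close>
  proof (cases hs rule: rev_cases)
    case Nil
    then show ?thesis
      using clinear_zero[OF cdual_apply_clinear[of \<gamma>]] by (simp add: taylor_form_def)
  next
    case (snoc ks h)
    then show ?thesis
      using dzero[of ks] by (cases ks) (auto simp: taylor_form_def ddir_cdual_apply split: list.splits)
  qed
  have "extend_form (taylor_form n (cdual_apply \<gamma>)) (replicate n z) = (if n = 1 then cdual_apply z \<gamma> else 0)" for n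
  proof (cases "n = 1")
    case True
    then show ?thesis
      by (simp add: form Lim_weak_star_filter)
  next
    case False
    have "extend_form (taylor_form n (cdual_apply \<gamma>)) (replicate n z) = extend_form (\<lambda>_. 0) (replicate n z)"
      by (rule extend_form_cong) (use False in \<open>auto simp: form split: list.splits\<close>)
    then show ?thesis
      using False by (simp add: extend_form_zero)
  qed
  then show ?thesis
    unfolding aron_berner_eq[OF entire_cdual_apply]
    using sums_unique[OF sums_single[of 1 "\<lambda>_. cdual_apply z \<gamma>"]] by simp
qed

section \<open>Radial weights\<close>

lemma power_powr_eq: "a > 0 \<Longrightarrow> (a ^ k) powr e = a powr (real k * e)" for a :: real
  using powr_powr[of a "real k" e] powr_realpow[of a k] by simp

locale radial_weights =
  fixes \<eta> :: "real \<Rightarrow> real" and v :: "nat \<Rightarrow> 'a::complex_normed_vector \<Rightarrow> real"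
  assumes eta_pos: "\<And>t. t \<ge> 0 \<Longrightarrow> \<eta> t > 0"
    and eta_antimono: "antimono_on {0..} \<eta>"
    and eta_decay: "\<And>k::nat. ((\<lambda>t. t ^ k * \<eta> t) \<longlongrightarrow> 0) at_top"
    and eta_mult: "\<exists>C>0. \<forall>s\<ge>0. \<forall>t\<ge>0. \<eta> s * \<eta> t \<le> C * \<eta> (s + t)"
    and weight_eq: "\<And>n x. n \<ge> 1 \<Longrightarrow> v n x = \<eta> (norm x) powr (1 / real n)"
begin

lemma eta_le: "0 \<le> s \<Longrightarrow> s \<le> t \<Longrightarrow> \<eta> t \<le> \<eta> s"
  using eta_antimono by (auto simp: monotone_on_def)

lemma weight_pos: "n \<ge> 1 \<Longrightarrow> v n x > 0"
  using eta_pos[of "norm x"] by (simp add: weight_eq)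

text \<open>Makes the seminorms directed: \<open>1 / m - 1 / n\<close> is a non-negative exponent
  and \<eta> is bounded by its value at 0.\<close>

lemma weight_le:
  assumes "1 \<le> m" "m \<le> n"
  shows "\<exists>c>0. \<forall>x. v m x \<le> c * v n x"
proof (intro exI conjI allI)
  define e where "e = 1 / real m - 1 / real n"
  have e: "e \<ge> 0"
    using assms by (simp add: e_def frac_le)
  show "\<eta> 0 powr e > 0"
    using eta_pos[of 0] by simp
  fix x
  have "v m x = \<eta> (norm x) powr e * v n x"
    using assms by (simp add: weight_eq e_def flip: powr_add)
  also have "\<dots> \<le> \<eta> 0 powr e * v n x"
    using e eta_pos[of "norm x"] eta_le[of 0 "norm x"] weight_pos[of n x] assms
    by (intro mult_right_mono powr_mono2) auto
  finally show "v m x \<le> \<eta> 0 powr e * v n x" .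
qed

text \<open>The growth condition iterated: a dilation of the argument by k is paid for by the k-th
  power of \<eta>.\<close>

lemma eta_power_le:
  assumes "k \<ge> 1"
  shows "\<exists>Q>0. \<forall>s\<ge>0. \<eta> s ^ k \<le> Q * \<eta> (real k * s)"
  using assms
proof (induction k rule: dec_induct)
  case base
  show ?case
    by (intro exI[of _ 1]) simp
next
  case (step k)
  obtain Q where Q: "Q > 0" "\<And>s. s \<ge> 0 \<Longrightarrow> \<eta> s ^ k \<le> Q * \<eta> (real k * s)"
    using step.IH by blast
  obtain C where C: "C > 0" "\<And>s t. s \<ge> 0 \<Longrightarrow> t \<ge> 0 \<Longrightarrow> \<eta> s * \<eta> t \<le> C * \<eta> (s + t)"
    using eta_mult by blast
  show ?case
  proof (intro exI[of _ "Q * C"] conjI allI impI)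
    fix s :: real assume s: "s \<ge> 0"
    have "\<eta> s ^ Suc k \<le> \<eta> s * (Q * \<eta> (real k * s))"
      using Q(2)[OF s] eta_pos[OF s] by simp
    also have "\<dots> = Q * (\<eta> s * \<eta> (real k * s))"
      by simp
    also have "\<dots> \<le> Q * (C * \<eta> (s + real k * s))"
      using Q(1) C(2)[of s "real k * s"] s by (intro mult_left_mono) auto
    finally show "\<eta> s ^ Suc k \<le> Q * C * \<eta> (real (Suc k) * s)"
      by (simp add: algebra_simps)
  qed (use Q C in simp)
qed

section \<open>The weighted space and its stability under translation by the bidual\<close>

lemma HV_I:
  assumes "entire f" "\<And>n. n \<ge> 1 \<Longrightarrow> \<exists>K. \<forall>x. v n x * cmod (f x) \<le> K"
  shows "f \<in> HV v"
  using assms by (auto simp: HV_def bdd_above_def)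

lemma HV_entire: "f \<in> HV v \<Longrightarrow> entire f"
  by (simp add: HV_def)

lemma HV_bound:
  assumes "f \<in> HV v" "n \<ge> 1"
  obtains K where "K \<ge> 0" "\<And>x. v n x * cmod (f x) \<le> K"
proof -
  obtain K where "\<And>x. v n x * cmod (f x) \<le> K"
    using assms by (auto simp: HV_def bdd_above_def)
  then show ?thesis
    by (intro that[of "max 0 K"]) (auto simp: le_max_iff_disj)
qed

lemma HV_add:
  assumes f: "f \<in> HV v" and g: "g \<in> HV v"
  shows "(\<lambda>x. f x + g x) \<in> HV v"
proof (rule HV_I)
  show "entire (\<lambda>x. f x + g x)"
    using assms by (intro entire_add HV_entire)
  fix n :: nat assume n: "n \<ge> 1"
  obtain K where K: "K \<ge> 0" "\<And>x. v n x * cmod (f x) \<le> K"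
    by (rule HV_bound[OF f n]) blast
  obtain L where L: "L \<ge> 0" "\<And>x. v n x * cmod (g x) \<le> L"
    by (rule HV_bound[OF g n]) blast
  have "v n x * cmod (f x + g x) \<le> K + L" for x
    using mult_left_mono[OF norm_triangle_ineq[of "f x" "g x"], of "v n x"] weight_pos[OF n, of x]
      K(2)[of x] L(2)[of x] by (simp add: distrib_left)
  then show "\<exists>K. \<forall>x. v n x * cmod (f x + g x) \<le> K"
    by blast
qed

lemma HV_cmult:
  assumes f: "f \<in> HV v"
  shows "(\<lambda>x. c * f x) \<in> HV v"
proof (rule HV_I)
  show "entire (\<lambda>x. c * f x)"
    using assms by (intro entire_cmult HV_entire)
  fix n :: nat assume n: "n \<ge> 1"
  obtain K where K: "K \<ge> 0" "\<And>x. v n x * cmod (f x) \<le> K"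
    by (rule HV_bound[OF f n]) blast
  have "v n x * cmod (c * f x) \<le> cmod c * K" for x
    using mult_left_mono[OF K(2)[of x], of "cmod c"] by (simp add: norm_mult mult_ac)
  then show "\<exists>K. \<forall>x. v n x * cmod (c * f x) \<le> K"
    by blast
qed

lemma HV_diff: "f \<in> HV v \<Longrightarrow> g \<in> HV v \<Longrightarrow> (\<lambda>x. f x - g x) \<in> HV v"
  using HV_add[OF _ HV_cmult[of g "-1"], of f] by simp

lemma HV_const: "(\<lambda>_. c) \<in> HV v"
proof (rule HV_I[OF entire_const])
  fix n :: nat assume n: "n \<ge> 1"
  have "v n x * cmod c \<le> \<eta> 0 powr (1 / real n) * cmod c" for x
    using n eta_pos[of "norm x"] eta_le[of 0 "norm x"]
    by (auto simp: weight_eq intro!: mult_right_mono powr_mono2)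
  then show "\<exists>K. \<forall>x::'a. v n x * cmod c \<le> K"
    by blast
qed

text \<open>For large norms, \<open>v n x * norm x\<close> is the n-th root of t^n * \<eta> t at t =
  \<open>norm x\<close>, so the decay of order n applies; for small norms \<eta> is at most
  \<open>\<eta> 0\<close>.\<close>

lemma weight_norm_bound:
  assumes n: "n \<ge> 1"
  shows "\<exists>K\<ge>0. \<forall>x. v n x * norm x \<le> K"
proof -
  have "\<forall>\<^sub>F t in at_top. t ^ n * \<eta> t < 1"
    using order_tendstoD(2)[OF eta_decay, of 1 n] by simp
  then obtain T where T: "\<And>t. t \<ge> T \<Longrightarrow> t ^ n * \<eta> t < 1"
    by (auto simp: eventually_at_top_linorder)
  have "v n x * norm x \<le> max 1 (\<eta> 0 powr (1 / real n) * \<bar>T\<bar>)" for x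
  proof (cases "norm x \<ge> T")
    case True
    have "v n x * norm x = (norm x ^ n * \<eta> (norm x)) powr (1 / real n)"
      using n eta_pos[of "norm x"]
      by (cases "x = 0") (simp_all add: weight_eq powr_mult power_powr_eq)
    also have "\<dots> \<le> 1 powr (1 / real n)"
      using T[OF True] eta_pos[of "norm x"] by (intro powr_mono2) auto
    finally show ?thesis
      by simp
  next
    case False
    have "v n x * norm x \<le> \<eta> 0 powr (1 / real n) * \<bar>T\<bar>"
      using False n eta_pos[of "norm x"] eta_le[of 0 "norm x"]
      by (auto simp: weight_eq intro!: mult_mono powr_mono2)
    then show ?thesis
      by simp
  qed
  then show ?thesis
    by (intro exI[of _ "max 1 (\<eta> 0 powr (1 / real n) * \<bar>T\<bar>)"]) auto
qed

text \<open>Uniformity in \<gamma> is the point: it makes the restriction of a character to the dual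
  a bounded functional, hence an element of the bidual.\<close>

lemma weight_cdual_apply_bound:
  assumes n: "n \<ge> 1"
  shows "\<exists>K\<ge>0. \<forall>\<gamma> x. v n x * cmod (cdual_apply \<gamma> x) \<le> K * norm \<gamma>"
proof -
  obtain K where K: "K \<ge> 0" "\<And>x. v n x * norm x \<le> K"
    using weight_norm_bound[OF n] by blast
  have "v n x * cmod (cdual_apply \<gamma> x) \<le> K * norm \<gamma>" for \<gamma> x
  proof -
    have "v n x * cmod (cdual_apply \<gamma> x) \<le> v n x * (norm \<gamma> * norm x)"
      using weight_pos[OF n, of x] by (intro mult_left_mono cmod_cdual_apply_le) simp
    also have "\<dots> = (v n x * norm x) * norm \<gamma>"
      by simp
    also have "\<dots> \<le> K * norm \<gamma>"
      by (intro mult_right_mono K) simp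
    finally show ?thesis .
  qed
  with K(1) show ?thesis
    by blast
qed

lemma HV_cdual_apply: "cdual_apply \<gamma> \<in> HV v"
  using weight_cdual_apply_bound by (intro HV_I entire_cdual_apply) blast

lemma HV_bounded_on_balls:
  assumes "f \<in> HV v"
  shows "\<exists>M. \<forall>y. norm y \<le> r \<longrightarrow> cmod (f y) \<le> M"
proof -
  obtain K where K: "K \<ge> 0" "\<And>y. v 1 y * cmod (f y) \<le> K"
    by (rule HV_bound[OF assms order_refl]) blast
  have "cmod (f y) \<le> K / \<eta> r" if "norm y \<le> r" for y
  proof -
    have r: "\<eta> r > 0"
      using that norm_ge_zero[of y] by (intro eta_pos) linarith
    have "\<eta> r * cmod (f y) \<le> \<eta> (norm y) * cmod (f y)"
      using eta_le[OF _ that] by (intro mult_right_mono) auto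
    also have "\<dots> \<le> K"
      using K(2)[of y] eta_pos[of "norm y"] by (simp add: weight_eq)
    finally show ?thesis
      using r by (simp add: field_simps)
  qed
  then show ?thesis
    by blast
qed

lemma HV_entire_aron_berner: "f \<in> HV v \<Longrightarrow> entire (aron_berner f)"
  by (intro entire_aron_berner HV_entire HV_bounded_on_balls)

text \<open>The crude estimate of the extension on a ball by the function on a ball of six times the
  radius is good enough, because the sixth root of each weight is again one of the weights.\<close>

lemma HV_aron_berner_bound:
  assumes f: "f \<in> HV v" and n: "n \<ge> 1" and a: "a \<ge> 0"
  obtains K where "K \<ge> 0"
    and "\<And>x w. norm w \<le> a \<Longrightarrow> v n x * cmod (aron_berner f (canonical_embedding x + w)) \<le> K"
proof -
  define m where "m = 6 * n"
  have m: "m \<ge> 1"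
    using n by (simp add: m_def)
  obtain L where L: "L \<ge> 0" "\<And>y. v m y * cmod (f y) \<le> L"
    by (rule HV_bound[OF f m]) blast
  obtain C where C: "C > 0" "\<And>s t. s \<ge> 0 \<Longrightarrow> t \<ge> 0 \<Longrightarrow> \<eta> s * \<eta> t \<le> C * \<eta> (s + t)"
    using eta_mult by blast
  obtain Q where Q: "Q > 0" "\<And>s. s \<ge> 0 \<Longrightarrow> \<eta> s ^ 6 \<le> Q * \<eta> (6 * s)"
    using eta_power_le[of 6] by auto
  \<comment> \<open>The first factor compares \<open>\<eta> (norm x)\<close> with \<eta> at the
    shifted radius \<open>s\<close> below; \<open>Q\<close> then dilates \<open>s\<close> to
    \<open>6 * s\<close>.\<close>
  define q where "q = (C / \<eta> (a + 1)) ^ 6 * Q"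
  have a1: "\<eta> (a + 1) > 0"
    using a by (intro eta_pos) simp
  have q: "q > 0"
    using a1 C(1) Q(1) by (simp add: q_def)
  have main: "v n x * cmod (aron_berner f (canonical_embedding x + w)) \<le> 2 * L * q powr (1 / real m)"
    if w: "norm w \<le> a" for x w
  proof -
    \<comment> \<open>The summand 1 keeps \<open>s\<close> positive when \<open>x\<close> and
      \<open>a\<close> are both 0.\<close>
    define s where "s = norm x + (a + 1)"
    define E where "E = \<eta> (6 * s) powr (1 / real m)"
    have s: "s > 0" "s \<ge> 0"
      using a norm_ge_zero[of x] by (auto simp: s_def simp del: norm_ge_zero)
    have E: "E > 0"
      using eta_pos[of "6 * s"] s by (simp add: E_def)
    have "cmod (f y) \<le> L / E" if y: "norm y \<le> 6 * s" for y
    proof -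
      have "E * cmod (f y) \<le> v m y * cmod (f y)"
        using eta_le[OF _ y] eta_pos[of "6 * s"] s m
        by (auto simp: E_def weight_eq intro!: mult_right_mono powr_mono2)
      then show ?thesis
        using L(2)[of y] E by (simp add: field_simps)
    qed
    moreover have "norm (canonical_embedding x + w) \<le> s"
      using norm_triangle_ineq[of "canonical_embedding x" w] canonical_embedding_apply(2)[of x] w
      by (simp add: s_def)
    ultimately have F: "cmod (aron_berner f (canonical_embedding x + w)) \<le> 2 * (L / E)"
      using aron_berner_bound[OF HV_entire[OF f] s(1)] by blast
    have "\<eta> (norm x) \<le> C / \<eta> (a + 1) * \<eta> s"
      using C(2)[of "norm x" "a + 1"] a a1 by (simp add: s_def field_simps)
    then have "\<eta> (norm x) ^ 6 \<le> (C / \<eta> (a + 1) * \<eta> s) ^ 6"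
      using eta_pos[of "norm x"] by (intro power_mono) auto
    also have "\<dots> \<le> (C / \<eta> (a + 1)) ^ 6 * (Q * \<eta> (6 * s))"
      unfolding power_mult_distrib using Q(2)[OF s(2)] by (intro mult_left_mono) auto
    finally have x6: "\<eta> (norm x) ^ 6 \<le> q * \<eta> (6 * s)"
      by (simp add: q_def)
    \<comment> \<open>Because 1/n = 6/m; the exponents on both sides now agree with the one in
      \<open>E\<close>, a lower bound of \<open>v m\<close> on the ball of radius
      \<open>6 * s\<close>.\<close>
    have "v n x = (\<eta> (norm x) ^ 6) powr (1 / real m)"
      using n eta_pos[of "norm x"] by (simp add: weight_eq m_def power_powr_eq)
    also have "\<dots> \<le> (q * \<eta> (6 * s)) powr (1 / real m)"
      using x6 eta_pos[of "norm x"] by (intro powr_mono2) auto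
    also have "\<dots> = q powr (1 / real m) * E"
      using q eta_pos[of "6 * s"] s by (simp add: E_def powr_mult)
    finally have "v n x * cmod (aron_berner f (canonical_embedding x + w))
        \<le> (q powr (1 / real m) * E) * (2 * (L / E))"
      using F weight_pos[OF n, of x] by (intro mult_mono) auto
    then show ?thesis
      using E by (simp add: mult_ac)
  qed
  show ?thesis
    by (rule that[OF _ main]) (use L in auto)
qed

text \<open>On the unit ball about \<open>canonical_embedding x + w\<close> the extension is at most
  \<open>K / v n x\<close>. The radius 1 is the same for all \<open>x\<close>, so Cauchy's estimates
  keep the weight at \<open>x\<close> intact; half that radius is the range allowed for
  \<open>h\<close> in the remainder.\<close>

lemma HV_aron_berner_derivative_bound:
  assumes f: "f \<in> HV v" and n: "n \<ge> 1"
  obtains K where "K \<ge> 0"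
    and "\<And>x h. v n x * cmod (ddir h (aron_berner f) (canonical_embedding x + w)) \<le> K * norm h"
    and "\<And>x h. norm h \<le> 1 / 2 \<Longrightarrow>
      v n x * cmod (aron_berner f (canonical_embedding x + w + h)
        - aron_berner f (canonical_embedding x + w)
        - ddir h (aron_berner f) (canonical_embedding x + w)) \<le> 8 * K * (norm h)\<^sup>2"
proof -
  obtain K where K: "K \<ge> 0" "\<And>x u. norm u \<le> norm w + 1 \<Longrightarrow>
      v n x * cmod (aron_berner f (canonical_embedding x + u)) \<le> K"
    by (rule HV_aron_berner_bound[OF f n, of "norm w + 1"]) simp_all
  note ent = HV_entire_aron_berner[OF f]
  have bound: "cmod (aron_berner f y) \<le> K / v n x"
    if "norm (y - (canonical_embedding x + w)) \<le> 1" for x y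
  proof -
    have "norm (y - canonical_embedding x) \<le> norm w + 1"
      using norm_triangle_ineq[of "y - (canonical_embedding x + w)" w] that by simp
    from K(2)[OF this, of x] show ?thesis
      using weight_pos[OF n, of x] by (simp add: field_simps)
  qed
  show ?thesis
  proof (rule that[OF K(1)])
    fix x h
    show "v n x * cmod (ddir h (aron_berner f) (canonical_embedding x + w)) \<le> K * norm h"
      using Cauchy_ddir[OF ent zero_less_one bound[of _ x], where h = h] weight_pos[OF n, of x]
      by (simp add: field_simps)
    assume h: "norm h \<le> 1 / 2"
    have "cmod (aron_berner f (canonical_embedding x + w + h)
        - aron_berner f (canonical_embedding x + w)
        - ddir h (aron_berner f) (canonical_embedding x + w)) \<le> 8 * (K / v n x) * (norm h)\<^sup>2 / 1\<^sup>2"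
      by (rule Cauchy_remainder[OF ent zero_less_one _ h]) (rule bound)
    then show "v n x * cmod (aron_berner f (canonical_embedding x + w + h)
        - aron_berner f (canonical_embedding x + w)
        - ddir h (aron_berner f) (canonical_embedding x + w)) \<le> 8 * K * (norm h)\<^sup>2"
      using weight_pos[OF n, of x] by (simp add: field_simps)
  qed
qed

lemma HV_bidual_translation:
  assumes f: "f \<in> HV v"
  shows "bidual_translation w f \<in> HV v"
proof (rule HV_I)
  show "entire (bidual_translation w f)"
    unfolding bidual_translation_def
    by (intro entire_compose_affine HV_entire_aron_berner f canonical_embedding_linear)
  show "\<exists>K. \<forall>x. v n x * cmod (bidual_translation w f x) \<le> K" if n: "n \<ge> 1" for n
  proof -
    obtain K where "K \<ge> 0" "\<And>x u. norm u \<le> norm w \<Longrightarrow>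
        v n x * cmod (aron_berner f (canonical_embedding x + u)) \<le> K"
      by (rule HV_aron_berner_bound[OF f n norm_ge_zero[of w]]) blast
    then show ?thesis
      unfolding bidual_translation_def by blast
  qed
qed

text \<open>Makes \<phi> applicable to this function; the result will be the derivative at
  \<open>w\<close> in direction \<open>h\<close>.\<close>

lemma HV_derivative_translation:
  assumes f: "f \<in> HV v"
  shows "(\<lambda>x. ddir h (aron_berner f) (canonical_embedding x + w)) \<in> HV v"
proof (rule HV_I)
  show "entire (\<lambda>x. ddir h (aron_berner f) (canonical_embedding x + w))"
    by (intro entire_compose_affine entire_ddir HV_entire_aron_berner f canonical_embedding_linear)
  show "\<exists>K. \<forall>x. v n x * cmod (ddir h (aron_berner f) (canonical_embedding x + w)) \<le> K"
    if n: "n \<ge> 1" for n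
  proof -
    obtain K where "\<And>x h. v n x * cmod (ddir h (aron_berner f) (canonical_embedding x + w))
        \<le> K * norm h"
      by (rule HV_aron_berner_derivative_bound[OF f n, of w]) blast
    then show ?thesis
      by blast
  qed
qed

section \<open>The spectrum\<close>

text \<open>Triangle inequality, with \<open>0 - f x\<close> written out to match what membership of
  the zero function in a generating ball says.\<close>

lemma weighted_norm_upper:
  assumes f: "f \<in> HV v" and g: "g \<in> HV v" and n: "n \<ge> 1"
    and \<delta>: "\<And>x. v n x * cmod (g x) \<le> \<delta>"
  shows "weighted_norm v n (\<lambda>x. g x - f x) \<le> \<delta> + weighted_norm v n (\<lambda>x. 0 - f x)"
  unfolding weighted_norm_def
proof (rule cSUP_least)
  fix x
  have "v n x * cmod (g x - f x) \<le> v n x * (cmod (g x) + cmod (0 - f x))"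
    using weight_pos[OF n, of x] norm_triangle_ineq4[of "g x" "f x"]
    by (intro mult_left_mono) auto
  also have "\<dots> = v n x * cmod (g x) + v n x * cmod (0 - f x)"
    by (simp add: distrib_left)
  also have "\<dots> \<le> \<delta> + (SUP x. v n x * cmod (0 - f x))"
    using f n by (intro add_mono \<delta> cSUP_upper) (auto simp: HV_def)
  finally show "v n x * cmod (g x - f x) \<le> \<delta> + (SUP x. v n x * cmod (0 - f x))" .
qed simp

text \<open>The generating balls have arbitrary centres and form only a subbasis, so the claim
  follows the generation of the topology: \<open>weight_le\<close> handles intersections by a common
  index, and the triangle inequality recentres a ball at 0.\<close>

lemma HV_topology_zero_nbhd:
  assumes "openin (HV_topology v) U" "(\<lambda>_. 0) \<in> U"
  shows "\<exists>n\<ge>1. \<exists>\<delta>>0. \<forall>g\<in>HV v. (\<forall>x. v n x * cmod (g x) \<le> \<delta>) \<longrightarrow> g \<in> U"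
proof -
  have "generate_topology_on
      {{g \<in> HV v. weighted_norm v n (\<lambda>x. g x - f x) < r} |f n r. f \<in> HV v \<and> n \<ge> 1 \<and> r > 0} U"
    using assms(1) unfolding HV_topology_def openin_topology_generated_by_iff .
  then show ?thesis
    using assms(2)
  proof induction
    case Empty
    then show ?case
      by simp
  next
    case (Int a b)
    then obtain n1 d1 n2 d2 where 1: "n1 \<ge> 1" "d1 > 0"
      "\<And>g. g \<in> HV v \<Longrightarrow> (\<And>x. v n1 x * cmod (g x) \<le> d1) \<Longrightarrow> g \<in> a"
      and 2: "n2 \<ge> 1" "d2 > 0"
      "\<And>g. g \<in> HV v \<Longrightarrow> (\<And>x. v n2 x * cmod (g x) \<le> d2) \<Longrightarrow> g \<in> b"
      by blast
    define n where "n = max n1 n2"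
    obtain c1 where c1: "c1 > 0" "\<And>x. v n1 x \<le> c1 * v n x"
      using weight_le[of n1 n] 1(1) by (auto simp: n_def)
    obtain c2 where c2: "c2 > 0" "\<And>x. v n2 x \<le> c2 * v n x"
      using weight_le[of n2 n] 2(1) by (auto simp: n_def)
    define d where "d = min (d1 / c1) (d2 / c2)"
    have le: "v k x * cmod (g x) \<le> e"
      if "v n x * cmod (g x) \<le> d" "c > 0" "v k x \<le> c * v n x" "d \<le> e / c" for k c e x and g :: "'a \<Rightarrow> complex"
    proof -
      have "v k x * cmod (g x) \<le> c * v n x * cmod (g x)"
        by (rule mult_right_mono[OF that(3)]) simp
      also have "\<dots> \<le> c * (e / c)"
        using that by (simp only: mult.assoc) (intro mult_left_mono, auto)
      finally show ?thesis
        using that(2) by simp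
    qed
    show ?case
    proof (intro exI conjI ballI impI)
      show "n \<ge> 1" "d > 0"
        using 1 2 c1(1) c2(1) by (auto simp: n_def d_def)
      fix g assume g: "g \<in> HV v" and "\<forall>x. v n x * cmod (g x) \<le> d"
      then have "v n1 x * cmod (g x) \<le> d1" "v n2 x * cmod (g x) \<le> d2" for x
        using le[of x g c1 n1 d1] le[of x g c2 n2 d2] c1 c2 by (auto simp: d_def)
      then show "g \<in> a \<inter> b"
        using 1(3)[OF g] 2(3)[OF g] by blast
    qed
  next
    case (UN \<K>)
    then obtain k where "k \<in> \<K>" "(\<lambda>_. 0) \<in> k"
      by blast
    then show ?case
      using UN.IH by blast
  next
    case (Basis s)
    then obtain f n r where s: "s = {g \<in> HV v. weighted_norm v n (\<lambda>x. g x - f x) < r}"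
      and f: "f \<in> HV v" and n: "n \<ge> 1"
      by blast
    \<comment> \<open>Half of the room that the zero function leaves to the boundary of the ball;
      halving restores the strict inequality.\<close>
    define \<delta> where "\<delta> = (r - weighted_norm v n (\<lambda>x. 0 - f x)) / 2"
    have \<delta>: "\<delta> > 0"
      using Basis.prems by (simp add: s \<delta>_def)
    have "g \<in> s" if "g \<in> HV v" "\<forall>x. v n x * cmod (g x) \<le> \<delta>" for g
      using weighted_norm_upper[OF f that(1) n, of \<delta>] that \<delta> by (auto simp: s \<delta>_def field_simps)
    with n \<delta> show ?case
      by blast
  qed
qed

section \<open>Continuous characters and their sheets\<close>

context
  fixes \<phi>
  assumes \<phi>: "\<phi> \<in> spectrum v"
begin

lemma functional_add: "f \<in> HV v \<Longrightarrow> g \<in> HV v \<Longrightarrow> \<phi> (\<lambda>x. f x + g x) = \<phi> f + \<phi> g"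
  and functional_cmult: "f \<in> HV v \<Longrightarrow> \<phi> (\<lambda>x. c * f x) = c * \<phi> f"
  and functional_mult: "f \<in> HV v \<Longrightarrow> g \<in> HV v \<Longrightarrow> \<phi> (\<lambda>x. f x * g x) = \<phi> f * \<phi> g"
  and functional_nonzero: "\<exists>f\<in>HV v. \<phi> f \<noteq> 0"
  and functional_continuous: "continuous_map (HV_topology v) euclidean \<phi>"
  using \<phi> unfolding spectrum_def by blast+

lemma functional_diff: "f \<in> HV v \<Longrightarrow> g \<in> HV v \<Longrightarrow> \<phi> (\<lambda>x. f x - g x) = \<phi> f - \<phi> g"
  using functional_add[OF _ HV_cmult[of g "-1"], of f] functional_cmult[of g "-1"] by simp

text \<open>Multiplying a function on which \<phi> does not vanish by 1 forces the value 1 at the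
  constant 1. This is why translation shifts the projection by exactly \<open>w\<close>.\<close>

lemma functional_const: "\<phi> (\<lambda>_. c) = c"
proof -
  obtain f where f: "f \<in> HV v" "\<phi> f \<noteq> 0"
    using functional_nonzero by blast
  have "\<phi> f = \<phi> (\<lambda>_. 1) * \<phi> f"
    using functional_mult[OF HV_const f(1), of 1] by simp
  then have "\<phi> (\<lambda>_. 1) = 1"
    using f(2) by simp
  then show ?thesis
    using functional_cmult[OF HV_const, of c 1] by simp
qed

text \<open>Continuity at 0 becomes domination by one weighted norm: scale \<open>g\<close> into a
  neighbourhood of 0 on which \<phi> has modulus below 1.\<close>

lemma functional_bound:
  obtains n L where "n \<ge> 1" "L \<ge> 0"
    and "\<And>g K. g \<in> HV v \<Longrightarrow> K \<ge> 0 \<Longrightarrow> (\<And>x. v n x * cmod (g x) \<le> K) \<Longrightarrow> cmod (\<phi> g) \<le> L * K"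
proof -
  define U where "U = {g \<in> topspace (HV_topology v). \<phi> g \<in> ball 0 1}"
  have top: "topspace (HV_topology v) = HV v"
  proof
    show "topspace (HV_topology v) \<subseteq> HV v"
      unfolding HV_topology_def topology_generated_by_topspace by blast
    show "HV v \<subseteq> topspace (HV_topology v)"
    proof
      fix f assume f: "f \<in> HV v"
      then have "f \<in> {g \<in> HV v. weighted_norm v 1 (\<lambda>x. g x - f x) < 1}"
        by (simp add: weighted_norm_def)
      then show "f \<in> topspace (HV_topology v)"
        unfolding HV_topology_def topology_generated_by_topspace using f
        by (intro UnionI[of "{g \<in> HV v. weighted_norm v 1 (\<lambda>x. g x - f x) < 1}"])
          (auto intro!: exI[of _ f] exI[of _ "1::nat"] exI[of _ "1::real"])
    qed
  qed
  have "openin (HV_topology v) U"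
    unfolding U_def by (rule openin_continuous_map_preimage[OF functional_continuous]) simp
  moreover have "(\<lambda>_. 0) \<in> U"
    using HV_const[of 0] functional_const[of 0] by (simp add: U_def top)
  ultimately obtain n \<delta> where n: "n \<ge> 1" and \<delta>: "\<delta> > 0"
    and U: "\<And>g. g \<in> HV v \<Longrightarrow> (\<And>x. v n x * cmod (g x) \<le> \<delta>) \<Longrightarrow> g \<in> U"
    using HV_topology_zero_nbhd by metis
  have "cmod (\<phi> g) \<le> 1 / \<delta> * K"
    if g: "g \<in> HV v" and K: "K \<ge> 0" "\<And>x. v n x * cmod (g x) \<le> K" for g K
  proof (rule field_le_epsilon)
    fix e :: real assume e: "e > 0"
    \<comment> \<open>The term \<open>e * \<delta>\<close> keeps the scaling factor well defined
      when \<open>K = 0\<close>; its contribution disappears as \<open>e\<close> tends to 0.\<close>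
    define t where "t = \<delta> / (K + e * \<delta>)"
    have t: "t > 0"
      using \<delta> K(1) e by (simp add: t_def add_nonneg_pos)
    have "(\<lambda>x. of_real t * g x) \<in> U"
    proof (rule U[OF HV_cmult[OF g]])
      fix x
      have "v n x * cmod (of_real t * g x) = t * (v n x * cmod (g x))"
        using t by (simp add: norm_mult)
      also have "\<dots> \<le> t * (K + e * \<delta>)"
        using K(2)[of x] e \<delta> t by (intro mult_left_mono) (auto intro: add_increasing2)
      also have "\<dots> = \<delta>"
        using add_nonneg_pos[OF K(1), of "e * \<delta>"] e \<delta> by (simp add: t_def)
      finally show "v n x * cmod (of_real t * g x) \<le> \<delta>" .
    qed
    then have "t * cmod (\<phi> g) < 1"
      using t by (simp add: U_def functional_cmult[OF g] norm_mult)
    then show "cmod (\<phi> g) \<le> 1 / \<delta> * K + e"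
      using add_nonneg_pos[OF K(1), of "e * \<delta>"] e \<delta> by (simp add: t_def field_simps)
  qed
  then show ?thesis
    using that[OF n, of "1 / \<delta>"] \<delta> by simp
qed

lemma entire_functional_translation:
  assumes f: "f \<in> HV v"
  shows "entire (\<lambda>w. \<phi> (bidual_translation w f))"
  unfolding entire_def
proof
  fix w
  define F where "F = aron_berner f"
  define T where "T h = (\<lambda>x. ddir h F (canonical_embedding x + w))" for h
  note entF = HV_entire_aron_berner[OF f, folded F_def]
  have T: "T h \<in> HV v" for h
    unfolding T_def F_def by (rule HV_derivative_translation[OF f])
  \<comment> \<open>The continuity of \<phi> fixes the weight first; derivative and remainder then
    have to be estimated for this single \<open>n\<close>.\<close>
  obtain n L where n: "n \<ge> 1" and L: "L \<ge> 0"
    "\<And>g K. g \<in> HV v \<Longrightarrow> K \<ge> 0 \<Longrightarrow> (\<And>x. v n x * cmod (g x) \<le> K) \<Longrightarrow> cmod (\<phi> g) \<le> L * K"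
    by (rule functional_bound) blast
  obtain K where K: "K \<ge> 0" "\<And>x h. v n x * cmod (T h x) \<le> K * norm h"
    "\<And>x h. norm h \<le> 1 / 2 \<Longrightarrow> v n x * cmod (F (canonical_embedding x + w + h)
        - F (canonical_embedding x + w) - T h x) \<le> 8 * K * (norm h)\<^sup>2"
    unfolding T_def F_def by (rule HV_aron_berner_derivative_bound[OF f n, of w]) blast
  have lin: "clinear (\<lambda>h. \<phi> (T h))"
    unfolding clinear_def
  proof (intro conjI allI)
    fix h k c
    have "T (h + k) = (\<lambda>x. T h x + T k x)" "T (c *\<^sub>C h) = (\<lambda>x. c * T h x)"
      using clinear_add[OF has_derivative_ddir(2)[OF entF]]
        clinear_scaleC[OF has_derivative_ddir(2)[OF entF]]
      by (auto simp: T_def scaleC_complex_def)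
    then show "\<phi> (T (h + k)) = \<phi> (T h) + \<phi> (T k)" "\<phi> (T (c *\<^sub>C h)) = c *\<^sub>C \<phi> (T h)"
      using functional_add[OF T T] functional_cmult[OF T] by (simp_all add: scaleC_complex_def)
  qed
  have "cmod (\<phi> (T h)) \<le> (L * K) * norm h" for h
    using L(2)[OF T, of "K * norm h" h] K(1,2) by (simp add: mult_ac)
  from clinear_bounded_linear[OF lin this] have bl: "bounded_linear (\<lambda>h. \<phi> (T h))" .
  have "((\<lambda>w. \<phi> (bidual_translation w f)) has_derivative (\<lambda>h. \<phi> (T h))) (at w)"
  proof (rule has_derivative_quadratic[OF bl])
    fix h :: "'a cdual cdual" assume h: "norm h \<le> 1 / 2"
    let ?R = "\<lambda>x. bidual_translation (w + h) f x - bidual_translation w f x - T h x"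
    have R: "?R \<in> HV v"
      by (intro HV_diff HV_bidual_translation f T)
    have "\<phi> ?R = \<phi> (bidual_translation (w + h) f) - \<phi> (bidual_translation w f) - \<phi> (T h)"
      by (simp add: functional_diff HV_diff HV_bidual_translation f T)
    moreover have "cmod (\<phi> ?R) \<le> L * (8 * K * (norm h)\<^sup>2)"
      by (rule L(2)[OF R])
        (use K(1,3) h in \<open>auto simp: bidual_translation_def F_def add.assoc\<close>)
    ultimately show "cmod (\<phi> (bidual_translation (w + h) f) - \<phi> (bidual_translation w f) - \<phi> (T h))
        \<le> L * (8 * K) * (norm h)\<^sup>2"
      by (simp add: mult.assoc)
  qed simp
  with lin show "\<exists>D. ((\<lambda>w. \<phi> (bidual_translation w f)) has_derivative D) (at w) \<and> clinear D"
    by blast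
qed

text \<open>Here \<open>z0\<close> is the projection of \<phi> itself. Translating a functional by
  \<open>w\<close> adds the constant \<open>cdual_apply w \<gamma>\<close>, which \<phi>
  reproduces.\<close>

lemma spectrum_proj_translation:
  "\<exists>z0. \<forall>w. spectrum_proj (compose (HV v) \<phi> (bidual_translation w)) = z0 + w"
proof -
  obtain n L where n: "n \<ge> 1" and L: "L \<ge> 0"
    "\<And>g K. g \<in> HV v \<Longrightarrow> K \<ge> 0 \<Longrightarrow> (\<And>x. v n x * cmod (g x) \<le> K) \<Longrightarrow> cmod (\<phi> g) \<le> L * K"
    by (rule functional_bound) blast
  obtain K where K: "K \<ge> 0" "\<And>\<gamma> x. v n x * cmod (cdual_apply \<gamma> x) \<le> K * norm \<gamma>"
    using weight_cdual_apply_bound[OF n] by blast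
  have lin: "clinear (\<lambda>\<gamma>. \<phi> (cdual_apply \<gamma>))"
    unfolding clinear_def
  proof (intro conjI allI)
    fix \<gamma> \<delta> :: "'a cdual" and c
    have "cdual_apply (\<gamma> + \<delta>) = (\<lambda>x. cdual_apply \<gamma> x + cdual_apply \<delta> x)"
      "cdual_apply (c *\<^sub>C \<gamma>) = (\<lambda>x. c * cdual_apply \<gamma> x)"
      by (auto simp: cdual_apply_add cdual_apply_scaleC)
    then show "\<phi> (cdual_apply (\<gamma> + \<delta>)) = \<phi> (cdual_apply \<gamma>) + \<phi> (cdual_apply \<delta>)"
      "\<phi> (cdual_apply (c *\<^sub>C \<gamma>)) = c *\<^sub>C \<phi> (cdual_apply \<gamma>)"
      using functional_add functional_cmult HV_cdual_apply by (simp_all add: scaleC_complex_def)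
  qed
  have "cmod (\<phi> (cdual_apply \<gamma>)) \<le> L * K * norm \<gamma>" for \<gamma>
    unfolding mult.assoc by (rule L(2)[OF HV_cdual_apply _ K(2)]) (use K(1) in simp)
  moreover have "L * K \<ge> 0"
    using L(1) K(1) by simp
  ultimately obtain z0 where z0: "cdual_apply z0 = (\<lambda>\<gamma>. \<phi> (cdual_apply \<gamma>))"
    by (rule cdual_of_clinear[OF lin])
  have "spectrum_proj (compose (HV v) \<phi> (bidual_translation w)) = z0 + w" for w
  proof -
    have "compose (HV v) \<phi> (bidual_translation w) (cdual_apply \<gamma>) = cdual_apply (z0 + w) \<gamma>" for \<gamma>
    proof -
      have "bidual_translation w (cdual_apply \<gamma>) = (\<lambda>x. cdual_apply \<gamma> x + cdual_apply w \<gamma>)"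
        by (simp add: bidual_translation_def aron_berner_cdual cdual_apply_add
            canonical_embedding_apply)
      then show ?thesis
        using functional_add[OF HV_cdual_apply HV_const]
        by (simp add: compose_eq HV_cdual_apply functional_const cdual_apply_add z0)
    qed
    then show ?thesis
      unfolding spectrum_proj_def by (intro the_equality) (auto intro: cdual_eqI)
  qed
  then show ?thesis
    by blast
qed

end

lemma holomorphic_on_spectrum_evaluation:
  assumes f: "f \<in> HV v"
  shows "holomorphic_on_spectrum v (\<lambda>\<phi>. \<phi> f)"
  unfolding holomorphic_on_spectrum_def
proof
  fix \<phi> assume \<phi>: "\<phi> \<in> spectrum v"
  let ?\<psi> = "\<lambda>w. compose (HV v) \<phi> (bidual_translation w)"
  obtain z0 where proj: "\<And>w. spectrum_proj (?\<psi> w) = z0 + w"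
    using spectrum_proj_translation[OF \<phi>] by blast
  have sheet: "spectrum_sheet v \<phi> = range ?\<psi>"
  proof
    show "spectrum_sheet v \<phi> \<subseteq> range ?\<psi>"
      unfolding spectrum_sheet_def spectrum_nbhd_def by blast
    have "?\<psi> w \<in> spectrum_nbhd v \<phi> (norm w + 1)" for w
      unfolding spectrum_nbhd_def by (intro CollectI exI[of _ w]) simp
    moreover have "norm w + 1 \<in> {0<..}" for w :: "'a cdual cdual"
      by (simp add: add_nonneg_pos)
    ultimately show "range ?\<psi> \<subseteq> spectrum_sheet v \<phi>"
      unfolding spectrum_sheet_def by blast
  qed
  \<comment> \<open>\<open>inv_into\<close> chooses some preimage in the sheet, but every point of
    the sheet is a translate by some \<open>w\<close> and projects to \<open>z0 + w\<close>, so the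
    choice is forced.\<close>
  have inv: "inv_into (spectrum_sheet v \<phi>) spectrum_proj z = ?\<psi> (z - z0)" for z
  proof -
    have z: "z \<in> spectrum_proj ` spectrum_sheet v \<phi>"
      unfolding sheet by (intro image_eqI[of z spectrum_proj "?\<psi> (z - z0)"] rangeI) (simp add: proj)
    obtain w where w: "inv_into (spectrum_sheet v \<phi>) spectrum_proj z = ?\<psi> w"
      using inv_into_into[OF z] unfolding sheet by blast
    then have "z = z0 + w"
      using f_inv_into_f[OF z] proj[of w] by simp
    with w show ?thesis
      by simp
  qed
  have "(\<lambda>\<phi>. \<phi> f) \<circ> inv_into (spectrum_sheet v \<phi>) spectrum_proj
      = (\<lambda>z. \<phi> (bidual_translation (z + - z0) f))"
  proof
    show "((\<lambda>\<phi>. \<phi> f) \<circ> inv_into (spectrum_sheet v \<phi>) spectrum_proj) z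
        = \<phi> (bidual_translation (z + - z0) f)" for z
      unfolding o_apply inv using f by (simp add: compose_eq)
  qed
  then show "entire ((\<lambda>\<phi>. \<phi> f) \<circ> inv_into (spectrum_sheet v \<phi>) spectrum_proj)"
    using entire_translate(1)[OF entire_functional_translation[OF \<phi> f], of "- z0"] by simp
qed

end

theorem theorem3p3:
  fixes \<eta> :: "real \<Rightarrow> real"
    and v :: "nat \<Rightarrow> 'a::complex_banach \<Rightarrow> real"
  assumes "symmetrically_regular TYPE('a)"
    and "\<And>t. t \<ge> 0 \<Longrightarrow> \<eta> t > 0"
    and "antimono_on {0..} \<eta>"
    and "continuous_on {0..} \<eta>"
    and "\<And>k::nat. ((\<lambda>t. t ^ k * \<eta> t) \<longlongrightarrow> 0) at_top"
    and "\<exists>C>0. \<forall>s\<ge>0. \<forall>t\<ge>0. \<eta> s * \<eta> t \<le> C * \<eta> (s + t)"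
    and "\<And>n x. n \<ge> 1 \<Longrightarrow> v n x = \<eta> (norm x) powr (1 / real n)"
  shows "\<forall>f\<in>HV v. holomorphic_on_spectrum v (\<lambda>\<phi>. \<phi> f)"
proof -
  interpret radial_weights \<eta> v
    by (rule radial_weights.intro[OF assms(2,3,5,6,7)])
  show ?thesis
    using holomorphic_on_spectrum_evaluation by blast
qed

end
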